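(* Let $(\Gamma,\mu)$ be a weighted graph (as described in the context: countably infinite, connected, locally uniformly finite) satisfying the polynomial volume condition: there exist $C_{dvp},D>0$ such that $$V(x,r)\le C_{dvp}\, r^D\, m(x)\qquad \forall x\in\Gamma,\ \forall r\in\mathbb N^*.$$ Then the following conditions are equivalent: (i) $P$ is analytic on $L^2$, that is, there exists $C>0$ such that for any $k\in\mathbb N^*$, $\|(I-P)P^k\|_{2\to2}\le \frac{C}{k}$; (ii) for any $q\in(1,+\infty)$, $P$ is analytic on $L^q$, that is, there exists $C_q>0$ such that for any $k\in\mathbb N^*$, $\|(I-P)P^k\|_{q\to q}\le\frac{C_q}{k}$; (iii) for all $q\in[1,+\infty]$, $-1\notin \mathrm{Sp}_{L^q}(P)$; (iv) there exists $q\in[1,+\infty)$ such that $-1\notin \mathrm{Sp}_{L^q}(P)$; (v) there exist $k\in\mathbb N$ and $\epsilon>0$ such that for all $x\in\Gamma$, $p_{2k+1}(x,x)\,m(x)\ge\epsilon$; (vi) there exist $\epsilon>0$ and $r_0\in\mathbb N^*$ such that, for all $x\in\Gamma$ and $r\in\mathbb N^*$, if the $\epsilon$-ball $B_\epsilon(x,r)$ is $\epsilon$-bipartite, then $r\le r_0$.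
   Context: $\mathbb N=\{0,1,2,\dots\}$ and $\mathbb N^*=\mathbb N\setminus\{0\}$. Graph. $\Gamma$ is a countably infinite set with a symmetric weight $\mu_{xy}=\mu_{yx}\ge0$ on $\Gamma\times\Gamma$. Write $x\sim y$ (neighbors) if $\mu_{xy}>0$ (the case $x=y$ is allowed). A path of length $n$ is a sequence $x_0,\dots,x_n$ with $x_{i-1}\sim x_i$ for $1\le i\le n$; $d(x,y)$ is the length of the shortest path from $x$ to $y$. The graph is assumed connected, i.e. $d(x,y)<+\infty$ for all $x,y\in\Gamma$, and locally uniformly finite: there is $N_{dvl}\in\mathbb N$ such that $\#(\{y\in\Gamma: y\sim x\}\cup\{x\})\le N_{dvl}$ for all $x\in\Gamma$. Put $m(x)=\sum_{y\sim x}\mu_{xy}$ (which is $>0$), $m(E)=\sum_{x\in E}m(x)$ for $E\subset\Gamma$, $B(x,r)=\{y: d(x,y)<r\}$, $V(x,r)=m(B(x,r))$. Function spaces. $L^q(\Gamma)=L^q(\Gamma,m)$, with $\|f\|_q=(\sum_x|f(x)|^qm(x))^{1/q}$ for $1\le q<\infty$ and the sup norm for $q=\infty$; $\|L\|_{q\to q}=\sup_{\|f\|_q=1}\|Lf\|_q$. $\mathrm{Sp}_{L^q}(P)$ denotes the spectrum of $P$ on (complex) $L^q(\Gamma)$. Random walk. $p(x,y)=\frac{\mu_{xy}}{m(x)m(y)}$, $p_0(x,y)=\frac{\delta(x,y)}{m(y)}$ (with $\delta(x,y)=1$ if $x=y$ and $0$ otherwise), $p_{k+1}(x,y)=\sum_{z\in\Gamma}p(x,z)p_k(z,y)m(z)$.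 The Markov operator is $Pf(x)=\sum_{y}p(x,y)f(y)m(y)$; $p_k$ is the kernel of $P^k$ with respect to $m$, and $P$ is a contraction on every $L^q(\Gamma)$, $q\in[1,\infty]$. $\epsilon$-notions. For $\epsilon>0$, write $x\sim_\epsilon y$ if $p(x,y)\min\{m(x),m(y)\}>\epsilon$. An $\epsilon$-path of length $n$ from $x$ to $y$ is a sequence $x=x_0,x_1,\dots,x_n=y$ with $x_{i-1}\sim_\epsilon x_i$ for $1\le i\le n$; it is closed if $x_0=x_n$. $d_\epsilon(x,y)$ is the length of the shortest $\epsilon$-path from $x$ to $y$ ($+\infty$ if there is none). The $\epsilon$-ball is $B_\epsilon(x,r)=\{y\in\Gamma: d_\epsilon(x,y)<r\}$. A set $E\subset\Gamma$ is called $\epsilon$-bipartite if all closed $\epsilon$-paths in $E$ (all of whose vertices lie in $E$) have even length; equivalently, $E=E_0\cup E_1$ with $E_0,E_1$ disjoint (possibly empty) and, for each $i\in\{0,1\}$, $x\not\sim_\epsilon y$ for all $x,y\in E_i$ (including $x=y$). *)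

theory Defs
  imports "HOL-Analysis.Analysis"
begin

text \<open>The graph and the \<open>\<epsilon>\<close>-graph differ only in the neighbour relation,
  so paths, distances and balls are defined for an arbitrary relation \<open>R\<close>.
  A path of length \<open>n\<close> is a sequence of which only the entries \<open>s 0, \<dots>, s n\<close> matter.\<close>

definition is_path :: "('a \<Rightarrow> 'a \<Rightarrow> bool) \<Rightarrow> nat \<Rightarrow> (nat \<Rightarrow> 'a) \<Rightarrow> bool" where
  "is_path R n s \<longleftrightarrow> (\<forall>i<n. R (s i) (s (Suc i)))"

text \<open>The infimum of the empty set in \<^typ>\<open>enat\<close> is \<open>\<infinity>\<close>.\<close>

definition path_dist :: "('a \<Rightarrow> 'a \<Rightarrow> bool) \<Rightarrow> 'a \<Rightarrow> 'a \<Rightarrow> enat" where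
  "path_dist R x y = Inf {enat n | n. \<exists>s. is_path R n s \<and> s 0 = x \<and> s n = y}"

definition path_ball :: "('a \<Rightarrow> 'a \<Rightarrow> bool) \<Rightarrow> 'a \<Rightarrow> nat \<Rightarrow> 'a set" where
  "path_ball R x r = {y. path_dist R x y < enat r}"

definition bipartite_in :: "('a \<Rightarrow> 'a \<Rightarrow> bool) \<Rightarrow> 'a set \<Rightarrow> bool" where
  "bipartite_in R E \<longleftrightarrow>
    (\<forall>n s. is_path R n s \<and> (\<forall>i\<le>n. s i \<in> E) \<and> s 0 = s n \<longrightarrow> even n)"

definition adj :: "('a \<Rightarrow> 'a \<Rightarrow> real) \<Rightarrow> 'a \<Rightarrow> 'a \<Rightarrow> bool" where
  "adj \<mu> x y \<longleftrightarrow> \<mu> x y > 0"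

text \<open>The vertex set is the whole type \<open>'a\<close>. Finiteness is stated separately
  because \<^const>\<open>card\<close> is \<open>0\<close> on infinite sets.\<close>

locale weighted_graph =
  fixes \<mu> :: "'a \<Rightarrow> 'a \<Rightarrow> real"
  assumes countable_vertices: "countable (UNIV :: 'a set)"
    and infinite_vertices: "infinite (UNIV :: 'a set)"
    and weight_sym: "\<mu> x y = \<mu> y x"
    and weight_nonneg: "\<mu> x y \<ge> 0"
    and connected: "path_dist (adj \<mu>) x y < \<infinity>"
    and locally_uniformly_finite:
      "\<exists>N::nat. \<forall>x. finite ({y. adj \<mu> y x} \<union> {x}) \<and> card ({y. adj \<mu> y x} \<union> {x}) \<le> N"

definition vmeas :: "('a \<Rightarrow> 'a \<Rightarrow> real) \<Rightarrow> 'a \<Rightarrow> real" where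
  "vmeas \<mu> x = (\<Sum>y | adj \<mu> x y. \<mu> x y)"

text \<open>Balls are finite in a locally finite graph, so the finite sum is the measure of the ball.\<close>

definition volume :: "('a \<Rightarrow> 'a \<Rightarrow> real) \<Rightarrow> 'a \<Rightarrow> nat \<Rightarrow> real" where
  "volume \<mu> x r = (\<Sum>y\<in>path_ball (adj \<mu>) x r. vmeas \<mu> y)"

definition polynomial_volume :: "('a \<Rightarrow> 'a \<Rightarrow> real) \<Rightarrow> bool" where
  "polynomial_volume \<mu> \<longleftrightarrow>
    (\<exists>C>0. \<exists>D>0. \<forall>x. \<forall>r\<ge>1. volume \<mu> x r \<le> C * real r powr D * vmeas \<mu> x)"

text \<open>The infinite sums in \<open>kern_iter\<close> and \<open>markov\<close> have finite support in a locally
  finite graph.\<close>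

definition kern :: "('a \<Rightarrow> 'a \<Rightarrow> real) \<Rightarrow> 'a \<Rightarrow> 'a \<Rightarrow> real" where
  "kern \<mu> x y = \<mu> x y / (vmeas \<mu> x * vmeas \<mu> y)"

primrec kern_iter :: "('a \<Rightarrow> 'a \<Rightarrow> real) \<Rightarrow> nat \<Rightarrow> 'a \<Rightarrow> 'a \<Rightarrow> real" where
  "kern_iter \<mu> 0 x y = (if x = y then 1 else 0) / vmeas \<mu> y"
| "kern_iter \<mu> (Suc k) x y = (\<Sum>\<^sub>\<infinity>z. kern \<mu> x z * kern_iter \<mu> k z y * vmeas \<mu> z)"

definition markov :: "('a \<Rightarrow> 'a \<Rightarrow> real) \<Rightarrow> ('a \<Rightarrow> complex) \<Rightarrow> 'a \<Rightarrow> complex" where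
  "markov \<mu> f x = (\<Sum>\<^sub>\<infinity>y. of_real (kern \<mu> x y) * f y * of_real (vmeas \<mu> y))"

definition eps_adj :: "('a \<Rightarrow> 'a \<Rightarrow> real) \<Rightarrow> real \<Rightarrow> 'a \<Rightarrow> 'a \<Rightarrow> bool" where
  "eps_adj \<mu> \<epsilon> x y \<longleftrightarrow> kern \<mu> x y * min (vmeas \<mu> x) (vmeas \<mu> y) > \<epsilon>"

abbreviation eps_ball :: "('a \<Rightarrow> 'a \<Rightarrow> real) \<Rightarrow> real \<Rightarrow> 'a \<Rightarrow> nat \<Rightarrow> 'a set" where
  "eps_ball \<mu> \<epsilon> \<equiv> path_ball (eps_adj \<mu> \<epsilon>)"

abbreviation eps_bipartite :: "('a \<Rightarrow> 'a \<Rightarrow> real) \<Rightarrow> real \<Rightarrow> 'a set \<Rightarrow> bool" where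
  "eps_bipartite \<mu> \<epsilon> \<equiv> bipartite_in (eps_adj \<mu> \<epsilon>)"

text \<open>The exponent \<open>q\<close> ranges over \<open>[1, \<infinity>]\<close>.\<close>

definition Lq :: "('a \<Rightarrow> real) \<Rightarrow> ereal \<Rightarrow> ('a \<Rightarrow> complex) set" where
  "Lq m q = (if q = \<infinity> then {f. bounded (range f)}
     else {f. (\<lambda>x. norm (f x) powr real_of_ereal q * m x) summable_on UNIV})"

text \<open>Meaningful only for \<open>f \<in> Lq m q\<close>.\<close>

definition Lq_norm :: "('a \<Rightarrow> real) \<Rightarrow> ereal \<Rightarrow> ('a \<Rightarrow> complex) \<Rightarrow> real" where
  "Lq_norm m q f = (if q = \<infinity> then (SUP x. norm (f x))
     else (\<Sum>\<^sub>\<infinity>x. norm (f x) powr real_of_ereal q * m x) powr (1 / real_of_ereal q))"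

text \<open>The operator norm takes values in the extended reals: the supremum of an unbounded
  set is \<open>\<infinity>\<close>, and so is the norm of an operator that does not preserve \<open>L\<^sup>q\<close>.\<close>

definition Lq_opnorm ::
  "('a \<Rightarrow> real) \<Rightarrow> ereal \<Rightarrow> (('a \<Rightarrow> complex) \<Rightarrow> 'a \<Rightarrow> complex) \<Rightarrow> ereal" where
  "Lq_opnorm m q T = (SUP f \<in> {f \<in> Lq m q. Lq_norm m q f = 1}.
     if T f \<in> Lq m q then ereal (Lq_norm m q (T f)) else \<infinity>)"

definition Lq_bounded_op ::
  "('a \<Rightarrow> real) \<Rightarrow> ereal \<Rightarrow> (('a \<Rightarrow> complex) \<Rightarrow> 'a \<Rightarrow> complex) \<Rightarrow> bool" where
  "Lq_bounded_op m q T \<longleftrightarrow>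
     (\<forall>f \<in> Lq m q. T f \<in> Lq m q) \<and>
     (\<forall>f \<in> Lq m q. \<forall>g \<in> Lq m q. T (\<lambda>x. f x + g x) = (\<lambda>x. T f x + T g x)) \<and>
     (\<forall>c. \<forall>f \<in> Lq m q. T (\<lambda>x. c * f x) = (\<lambda>x. c * T f x)) \<and>
     (\<exists>C. \<forall>f \<in> Lq m q. Lq_norm m q (T f) \<le> C * Lq_norm m q f)"

text \<open>The spectrum of a bounded operator \<open>T\<close>: those \<open>z\<close> for which \<open>z I - T\<close> has no
  bounded two-sided inverse \<open>S\<close> on \<open>L\<^sup>q\<close>.\<close>

definition Lq_spectrum ::
  "('a \<Rightarrow> real) \<Rightarrow> ereal \<Rightarrow> (('a \<Rightarrow> complex) \<Rightarrow> 'a \<Rightarrow> complex) \<Rightarrow> complex set" where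
  "Lq_spectrum m q T = {z. \<not> (\<exists>S. Lq_bounded_op m q S \<and>
     (\<forall>f \<in> Lq m q. S (\<lambda>x. z * f x - T f x) = f \<and> (\<lambda>x. z * S f x - T (S f) x) = f))}"

definition markov_analytic :: "('a \<Rightarrow> 'a \<Rightarrow> real) \<Rightarrow> ereal \<Rightarrow> bool" where
  "markov_analytic \<mu> q \<longleftrightarrow> (\<exists>C>0. \<forall>k\<ge>1.
     Lq_opnorm (vmeas \<mu>) q
       (\<lambda>f x. (markov \<mu> ^^ k) f x - markov \<mu> ((markov \<mu> ^^ k) f) x) \<le> ereal (C / real k))"

end

theory Submission
  imports Defs "HOL-Real_Asymp.Real_Asymp"
begin

text \<open>All conditions are linked through an estimate from below
  \<open>\<parallel>f\<parallel> \<le> G \<parallel>(I + P) f\<parallel>\<close> on \<open>L\<^sup>q\<close>. It follows from (iv), and from (i) by telescoping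
  \<open>2 f = (I - P) P\<^sup>k f + (f - P\<^sup>k f) + (f + P\<^sup>k\<^sup>+\<^sup>1 f)\<close> with \<open>k\<close> even and large. It implies (vi): on a
  bipartite \<open>\<epsilon>\<close>-ball the alternating function, cut off at a radius where the ball has a thin
  boundary (which polynomial growth provides), almost satisfies \<open>P f = - f\<close>. A non-bipartite ball
  contains an edge between two vertices at distances of equal parity from the centre, so (vi)
  yields closed paths of a fixed odd length, which is (v). Under (v), \<open>P\<^sup>n = e I + (1 - e) Q\<close> with
  \<open>n\<close> odd and \<open>Q\<close> again a reversible Markov operator, so \<open>I + P\<^sup>n\<close>, and hence its divisor \<open>I + P\<close>, is
  invertible on every \<open>L\<^sup>q\<close>.

  For (ii) it remains to see that \<open>P\<^sup>2\<close> is always analytic on \<open>L\<^sup>q\<close> for \<open>1 < q < \<infinity>\<close>; no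
  interpolation is needed. Uniform convexity bounds \<open>\<parallel>(I - R\<^sup>2) f\<parallel>\<^sup>q\<close> by the energy loss
  \<open>\<parallel>f\<parallel>\<^sup>q - \<parallel>R f\<parallel>\<^sup>q\<close> up to a small error, for all reversible Markov operators \<open>R\<close> with the same
  constants. Taking \<open>R = P\<^sup>n\<close> and adding up \<open>M\<close> steps gives \<open>\<parallel>(I - S\<^sup>n) S\<^sup>n\<^sup>M\<parallel> \<le> 1/4\<close> for \<open>S = P\<^sup>2\<close>
  uniformly in \<open>n\<close>, and the identity \<open>n (I - S) = (I - S\<^sup>n) + (\<Sum>j<n. (I - S\<^sup>j) (I - S))\<close> turns this
  into a recursive bound for \<open>\<parallel>(I - S) S\<^sup>k\<parallel>\<close>.\<close>

section \<open>Paths, balls and parity\<close>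

text \<open>Trades the infimum in \<open>enat\<close> for relational powers, so that concatenating
  and reversing paths becomes composition of relations.\<close>

lemma path_ball_iff: "y \<in> path_ball R x r \<longleftrightarrow> (\<exists>n<r. (R ^^ n) x y)"
proof -
  have "y \<in> path_ball R x r \<longleftrightarrow> (\<exists>n. enat n < enat r \<and> (\<exists>s. is_path R n s \<and> s 0 = x \<and> s n = y))"
    unfolding path_ball_def path_dist_def
    by (auto simp: Inf_less_iff simp flip: enat_ord_simps(2))
  also have "\<dots> \<longleftrightarrow> (\<exists>n<r. (R ^^ n) x y)"
    unfolding relpowp_fun_conv is_path_def by auto
  finally show ?thesis .
qed

lemma path_dist_finiteD:
  assumes "path_dist R x y < \<infinity>"
  obtains n where "(R ^^ n) x y"
proof -
  have "\<exists>r. path_dist R x y < enat r"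
    using assms by (metis enat_ord_simps(2) lessI less_infinityE)
  then show ?thesis
    using path_ball_iff[of y R x] that unfolding path_ball_def by blast
qed

lemma center_in_path_ball: "0 < r \<Longrightarrow> x \<in> path_ball R x r"
  unfolding path_ball_iff by (rule exI[of _ 0]) auto

lemma path_ball_mono: "r \<le> s \<Longrightarrow> path_ball R x r \<subseteq> path_ball R x s"
  unfolding path_ball_iff subset_iff by (meson less_le_trans)

lemma path_ball_mono_rel:
  assumes "\<And>x y. R x y \<Longrightarrow> S x y"
  shows "path_ball R x r \<subseteq> path_ball S x r"
  unfolding path_ball_iff subset_iff using relpowp_mono[of R S] assms by metis

lemma path_ball_step: "y \<in> path_ball R x r \<Longrightarrow> R y z \<Longrightarrow> z \<in> path_ball R x (Suc r)"
  unfolding path_ball_iff by (meson Suc_mono relpowp_Suc_I)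

lemma path_ball_1: "path_ball R x (Suc 0) = {x}"
  by (auto simp: path_ball_iff)

lemma finite_path_ball:
  assumes "\<And>x. finite {y. R x y}"
  shows "finite (path_ball R x r)"
proof (induction r)
  case 0
  then show ?case by (simp add: path_ball_def flip: zero_enat_def)
next
  case (Suc r)
  have "path_ball R x (Suc r) \<subseteq> insert x (\<Union>y\<in>path_ball R x r. {z. R y z})"
  proof
    fix z assume "z \<in> path_ball R x (Suc r)"
    then obtain n where n: "n < Suc r" "(R ^^ n) x z" by (auto simp: path_ball_iff)
    show "z \<in> insert x (\<Union>y\<in>path_ball R x r. {z. R y z})"
    proof (cases n)
      case 0
      then show ?thesis using n by auto
    next
      case (Suc k)
      then have "(R ^^ Suc k) x z" "k < r" using n by auto
      then obtain y where "(R ^^ k) x y" "R y z" by (meson relpowp_Suc_E)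
      then have "y \<in> path_ball R x r" unfolding path_ball_iff using \<open>k < r\<close> by blast
      then show ?thesis using \<open>R y z\<close> by blast
    qed
  qed
  then show ?case using Suc assms by (meson finite.insertI finite_UN_I finite_subset)
qed

lemma relpowp_sym:
  assumes "symp R" "(R ^^ n) x y"
  shows "(R ^^ n) y x"
  using assms(2)
proof (induction n arbitrary: y)
  case (Suc n)
  obtain w where "(R ^^ n) x w" "R w y" using Suc.prems by (rule relpowp_Suc_E)
  then show ?case using relpowp_Suc_I2[OF sympD[OF \<open>symp R\<close>] Suc.IH] by blast
qed auto

text \<open>The graph distance as a natural number. \<open>LEAST\<close> carries information only
  for reachable \<open>y\<close>, in particular for \<open>y\<close> in a ball around
  \<open>x\<close>.\<close>

definition hops :: "('a \<Rightarrow> 'a \<Rightarrow> bool) \<Rightarrow> 'a \<Rightarrow> 'a \<Rightarrow> nat" where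
  "hops R x y = (LEAST n. (R ^^ n) x y)"

lemma hops_path_ball:
  assumes "y \<in> path_ball R x r"
  shows "(R ^^ hops R x y) x y" "hops R x y < r"
proof -
  obtain n where n: "n < r" "(R ^^ n) x y" using assms by (auto simp: path_ball_iff)
  show "(R ^^ hops R x y) x y"
    unfolding hops_def using n(2) by (rule LeastI[where P = "\<lambda>n. (R ^^ n) x y"])
  show "hops R x y < r" unfolding hops_def using Least_le[of "\<lambda>n. (R ^^ n) x y", OF n(2)] n(1) by simp
qed

text \<open>Every prefix of a path from \<open>x\<close> of length below \<open>r\<close> is itself
  such a path, so the whole path stays in the ball.\<close>

lemma relpowp_pathE:
  assumes "(R ^^ a) x y" "a < r"
  obtains s where "s 0 = x" "s a = y" "\<And>i. i < a \<Longrightarrow> R (s i) (s (Suc i))"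
    "\<And>i. i \<le> a \<Longrightarrow> s i \<in> path_ball R x r"
proof -
  obtain s where s: "s 0 = x" "s a = y" "\<forall>i<a. R (s i) (s (Suc i))"
    using assms(1) unfolding relpowp_fun_conv by blast
  have "s i \<in> path_ball R x r" if "i \<le> a" for i
  proof -
    have "(R ^^ i) x (s i)" unfolding relpowp_fun_conv using s that by (intro exI[of _ s]) auto
    then show ?thesis unfolding path_ball_iff using that assms(2) by (meson le_less_trans)
  qed
  then show ?thesis using s that by blast
qed

text \<open>Shortest paths from \<open>x\<close> to \<open>y\<close> and to \<open>z\<close>, joined
  by the edge from \<open>y\<close> to \<open>z\<close>, form a closed path in the ball of length
  \<open>a + 1 + b\<close>. Bipartiteness makes this length even.\<close>

lemma bipartite_in_path_ballD:
  assumes "symp R" "bipartite_in R (path_ball R x r)"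
    and "y \<in> path_ball R x r" "z \<in> path_ball R x r" "R y z"
  shows "even (hops R x y) \<noteq> even (hops R x z)"
proof -
  define a b where "a = hops R x y" and "b = hops R x z"
  obtain s where s: "s 0 = x" "s a = y" "\<And>i. i < a \<Longrightarrow> R (s i) (s (Suc i))"
    "\<And>i. i \<le> a \<Longrightarrow> s i \<in> path_ball R x r"
    unfolding a_def by (rule relpowp_pathE[OF hops_path_ball[OF assms(3)]]) blast
  obtain t where t: "t 0 = x" "t b = z" "\<And>i. i < b \<Longrightarrow> R (t i) (t (Suc i))"
    "\<And>i. i \<le> b \<Longrightarrow> t i \<in> path_ball R x r"
    unfolding b_def by (rule relpowp_pathE[OF hops_path_ball[OF assms(4)]]) blast
  \<comment> \<open>Runs along \<open>s\<close> to \<open>y\<close>, crosses the edge at index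
    \<open>a\<close>, then follows \<open>t\<close> backwards from \<open>t b = z\<close> to
    \<open>t 0 = x\<close>.\<close>
  define u where "u i = (if i \<le> a then s i else t (a + 1 + b - i))" for i
  have "is_path R (a + 1 + b) u"
    unfolding is_path_def
  proof (intro allI impI)
    fix i assume i: "i < a + 1 + b"
    consider "i < a" | "i = a" | "a < i" by linarith
    then show "R (u i) (u (Suc i))"
    proof cases
      case 3
      then have "R (t (Suc (a + b - i))) (t (a + b - i))"
        using i t(3)[of "a + b - i"] sympD[OF \<open>symp R\<close>] by simp
      then show ?thesis using 3 i by (simp add: u_def Suc_diff_le)
    qed (use s t assms(5) in \<open>auto simp: u_def\<close>)
  qed
  moreover have "\<forall>i\<le>a + 1 + b. u i \<in> path_ball R x r"
    using s(4) t(4) by (auto simp: u_def)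
  moreover have "u 0 = u (a + 1 + b)" using s t by (simp add: u_def)
  ultimately have "even (a + 1 + b)"
    using assms(2) unfolding bipartite_in_def by blast
  then show ?thesis by (auto simp: a_def b_def)
qed

text \<open>The parity of \<open>hops\<close> flips at each step of a path inside the ball, so
  returning to the start takes an even number of steps.\<close>

lemma bipartite_in_path_ballI:
  assumes "\<And>y z. y \<in> path_ball R x r \<Longrightarrow> z \<in> path_ball R x r \<Longrightarrow> R y z
      \<Longrightarrow> even (hops R x y) \<noteq> even (hops R x z)"
  shows "bipartite_in R (path_ball R x r)"
  unfolding bipartite_in_def
proof (intro allI impI)
  fix n s assume *: "is_path R n s \<and> (\<forall>i\<le>n. s i \<in> path_ball R x r) \<and> s 0 = s n"
  have "even i \<longleftrightarrow> even (hops R x (s i)) = even (hops R x (s 0))" if "i \<le> n" for i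
    using that
  proof (induction i)
    case (Suc i)
    then show ?case using assms[of "s i" "s (Suc i)"] * by (auto simp: is_path_def)
  qed simp
  then show "even n" using * by (metis order_refl)
qed

text \<open>Some edge of the ball joins vertices of equal parity, both at distance at most
  \<open>r\<close>. Going out, over this edge and back is an odd closed path of length at most
  \<open>2 * r + 1\<close>. Moving back and forth along an edge at \<open>x\<close> pads it to
  exactly this length, which is the same for all \<open>x\<close>.\<close>

lemma odd_closed_path:
  assumes "symp R" "\<not> bipartite_in R (path_ball R x (Suc r))"
  shows "(R ^^ (2 * r + 1)) x x"
proof -
  obtain y z where yz: "y \<in> path_ball R x (Suc r)" "z \<in> path_ball R x (Suc r)" "R y z"
    "even (hops R x y) = even (hops R x z)"
    using bipartite_in_path_ballI[of R x "Suc r"] assms(2) by blast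
  define n where "n = Suc (hops R x y) + hops R x z"
  have "(R ^^ n) x x"
    unfolding n_def
    by (rule relpowp_trans[OF relpowp_Suc_I relpowp_sym])
      (use hops_path_ball[OF yz(1)] hops_path_ball[OF yz(2)] yz(3) assms(1) in auto)
  moreover have "odd n" "n \<le> 2 * r + 1"
    using yz(4) hops_path_ball[OF yz(1)] hops_path_ball[OF yz(2)] by (auto simp: n_def)
  moreover obtain w where "R x w"
    using \<open>(R ^^ n) x x\<close> unfolding n_def add_Suc by (rule relpowp_Suc_E2)
  have loop: "(R ^^ (2 * j)) x x" for j
  proof (induction j)
    case (Suc j)
    have "(R ^^ Suc (2 * j)) x w" using Suc \<open>R x w\<close> by (rule relpowp_Suc_I)
    then have "(R ^^ Suc (Suc (2 * j))) x x" using sympD[OF \<open>symp R\<close> \<open>R x w\<close>] by (rule relpowp_Suc_I)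
    then show ?case by (simp only: mult_Suc_right add_2_eq_Suc)
  qed simp
  have "2 * r + 1 = n + 2 * ((2 * r + 1 - n) div 2)"
    using \<open>odd n\<close> \<open>n \<le> 2 * r + 1\<close> by presburger
  then show ?thesis using relpowp_trans[OF \<open>(R ^^ n) x x\<close> loop] by metis
qed

section \<open>Convexity of powers\<close>

text \<open>Bernoulli's inequality: the power lies above its tangent at 1. The mean value theorem is
  applied between \<open>s\<close> and 1, where the derivative is strictly monotone.\<close>

lemma powr_ge_tangent:
  fixes q s :: real
  assumes "1 \<le> q" "0 \<le> s"
  shows "q * s \<le> s powr q + (q - 1)"
    and "1 < q \<Longrightarrow> s \<noteq> 1 \<Longrightarrow> q * s < s powr q + (q - 1)"
proof -
  have strict: "q * s < s powr q + (q - 1)" if "1 < q" "s \<noteq> 1"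
  proof (cases "s = 0")
    case True
    then show ?thesis using that by simp
  next
    case False
    then have s: "0 < s" using assms by simp
    have D: "((\<lambda>t. t powr q) has_real_derivative q * t powr (q - 1)) (at t)" if "0 < t" for t
      using that by (auto intro!: derivative_eq_intros)
    show ?thesis
    proof (cases "1 < s")
      case True
      then obtain z where z: "1 < z" "z < s" "s powr q - 1 powr q = (s - 1) * (q * z powr (q - 1))"
        using MVT2[of 1 s "\<lambda>t. t powr q" "\<lambda>t. q * t powr (q - 1)"] D by auto
      have "1 < z powr (q - 1)" using z \<open>1 < q\<close> by (simp add: gr_one_powr)
      then have "(s - 1) * (q * 1) < (s - 1) * (q * z powr (q - 1))"
        using True \<open>1 < q\<close> by (intro mult_strict_left_mono) auto
      then show ?thesis using z by (simp add: algebra_simps)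
    next
      case False
      then have "s < 1" using \<open>s \<noteq> 1\<close> by simp
      then obtain z where z: "s < z" "z < 1" "1 powr q - s powr q = (1 - s) * (q * z powr (q - 1))"
        using MVT2[of s 1 "\<lambda>t. t powr q" "\<lambda>t. q * t powr (q - 1)"] D s by auto
      have "z powr (q - 1) < 1" using z s \<open>1 < q\<close> powr_less_mono2[of "q - 1" z 1] by simp
      then have "(1 - s) * (q * z powr (q - 1)) < (1 - s) * (q * 1)"
        using \<open>s < 1\<close> \<open>1 < q\<close> by (intro mult_strict_left_mono) auto
      then show ?thesis using z by (simp add: algebra_simps)
    qed
  qed
  then show "1 < q \<Longrightarrow> s \<noteq> 1 \<Longrightarrow> q * s < s powr q + (q - 1)" .
  show "q * s \<le> s powr q + (q - 1)"
    using strict assms by (cases "q = 1"; cases "s = 1") (auto simp: less_imp_le)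
qed

text \<open>The left-hand side is compared with the gap between \<open>\<bar>t\<bar>\<^sup>q\<close> and its tangent at \<open>1\<close>, which is
  positive away from \<open>1\<close>: by compactness for bounded \<open>t\<close>, by growth for large \<open>t\<close>.\<close>

lemma powr_convexity_defect:
  fixes q \<delta> :: real
  assumes q: "1 < q" and \<delta>: "0 < \<delta>"
  obtains C where "1 \<le> C"
    "\<And>t::complex. norm (t - 1) powr q
       \<le> \<delta> * (1 + norm t powr q) + C * (norm t powr q + (q - 1) - q * Re t)"
proof -
  define G where "G t = norm t powr q + (q - 1) - q * Re t" for t :: complex
  have G0: "0 \<le> G t" for t
    using powr_ge_tangent(1)[of q "norm t", OF _ norm_ge_zero] q
      mult_left_mono[OF complex_Re_le_cmod[of t], of q]
    unfolding G_def by linarith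
  have Gpos: "0 < G t" if "t \<noteq> 1" for t
  proof (cases "norm t = 1")
    case False
    then show ?thesis
      using powr_ge_tangent(2)[of q "norm t", OF _ norm_ge_zero] q
        mult_left_mono[OF complex_Re_le_cmod[of t], of q]
      unfolding G_def by linarith
  next
    \<comment> \<open>On the unit circle the tangent inequality for the modulus is an equality;
      strictness comes from \<open>Re t < 1\<close>.\<close>
    case True
    then have "Re t \<noteq> 1" using that cmod_power2[of t] by (auto simp: complex_eq_iff)
    then have "Re t < 1" using complex_Re_le_cmod[of t] True by linarith
    then show ?thesis using True q by (simp add: G_def)
  qed
  \<comment> \<open>Beyond this radius \<open>q * norm t\<close> is at most half of
    \<open>norm t powr q\<close>, so \<open>G t\<close> is at least the other half.\<close>
  define r where "r = max 1 ((2 * q) powr (1 / (q - 1)))"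
  have far: "norm (t - 1) powr q \<le> (2 * 2 powr q) * G t" if t: "r \<le> norm t" for t
  proof -
    have t1: "1 \<le> norm t" using t by (simp add: r_def)
    have "2 * q = ((2 * q) powr (1 / (q - 1))) powr (q - 1)" using q by (simp add: powr_powr)
    also have "\<dots> \<le> norm t powr (q - 1)"
      using t q by (intro powr_mono2) (auto simp: r_def)
    finally have "2 * q * norm t \<le> norm t powr (q - 1) * norm t"
      by (intro mult_right_mono) auto
    also have "\<dots> = norm t powr q" using t1 by (simp add: powr_mult_base mult.commute)
    finally have "norm t powr q / 2 \<le> G t"
      using q mult_left_mono[OF complex_Re_le_cmod[of t], of q] unfolding G_def by linarith
    moreover have "norm (t - 1) powr q \<le> (2 * norm t) powr q"
      using q t1 norm_triangle_ineq4[of t 1] by (intro powr_mono2) auto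
    then have "norm (t - 1) powr q \<le> 2 powr q * norm t powr q"
      by (simp add: powr_mult)
    moreover have "2 powr q * norm t powr q \<le> 2 powr q * (2 * G t)"
      using calculation(1) by (intro mult_left_mono) auto
    ultimately have "norm (t - 1) powr q \<le> 2 powr q * (2 * G t)" by linarith
    then show ?thesis by (simp only: mult_ac)
  qed
  \<comment> \<open>The bounded points at which the left-hand side is not already below
    \<open>\<delta>\<close>. This compact set avoids 1, hence \<open>G\<close> has a positive
    minimum on it.\<close>
  define K where "K = cball 0 r \<inter> {t::complex. \<delta> \<le> norm (t - 1) powr q}"
  have "\<exists>c>0. \<forall>t\<in>K. c \<le> G t"
  proof (cases "K = {}")
    case False
    have "closed {t::complex. \<delta> \<le> norm (t - 1) powr q}"
      by (intro closed_Collect_le continuous_intros continuous_on_powr') (use q in auto)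
    then have "compact K" unfolding K_def by (intro compact_Int_closed) auto
    moreover have "continuous_on K G"
      unfolding G_def by (intro continuous_intros continuous_on_powr') (use q in auto)
    ultimately obtain t0 where t0: "t0 \<in> K" "\<forall>t\<in>K. G t0 \<le> G t"
      using continuous_attains_inf False by blast
    then have "t0 \<noteq> 1" using \<delta> by (auto simp: K_def)
    then show ?thesis using Gpos t0 by blast
  qed (auto intro: exI[of _ 1])
  then obtain c where c: "0 < c" "\<And>t. t \<in> K \<Longrightarrow> c \<le> G t" by blast
  have near: "norm (t - 1) powr q \<le> ((r + 1) powr q / c) * G t" if "t \<in> K" for t
  proof -
    have "norm (t - 1) \<le> r + 1" using that norm_triangle_ineq4[of t 1] by (simp add: K_def)
    then have "norm (t - 1) powr q \<le> (r + 1) powr q" using q by (intro powr_mono2) auto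
    also have "\<dots> \<le> (r + 1) powr q * (G t / c)"
      using c that by (intro mult_le_cancel_left1[THEN iffD2]) auto
    finally show ?thesis by (simp add: field_simps)
  qed
  define C where "C = max 1 (max (2 * 2 powr q) ((r + 1) powr q / c))"
  have "norm (t - 1) powr q \<le> \<delta> * (1 + norm t powr q) + C * G t" for t
  proof -
    have d0: "0 \<le> \<delta> * (1 + norm t powr q)" "\<delta> \<le> \<delta> * (1 + norm t powr q)" using \<delta> by auto
    consider "r \<le> norm t" | "t \<in> K" | "norm (t - 1) powr q < \<delta>" by (force simp: K_def)
    then show ?thesis
    proof cases
      case 1
      have "2 * 2 powr q * G t \<le> C * G t" by (intro mult_right_mono G0) (simp add: C_def)
      then show ?thesis using far[OF 1] d0 by linarith
    next
      case 2
      have "((r + 1) powr q / c) * G t \<le> C * G t" by (intro mult_right_mono G0) (simp add: C_def)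
      then show ?thesis using near[OF 2] d0 by linarith
    next
      case 3
      have "0 \<le> C * G t" using G0 by (simp add: C_def)
      then show ?thesis using 3 d0 by linarith
    qed
  qed
  then show ?thesis using that[of C] by (simp add: G_def C_def)
qed

text \<open>The tangent inequality at the mean \<open>a\<close> of the moduli, averaged with weights
  \<open>w\<close>; the linear terms cancel.\<close>

lemma complex_jensen_powr:
  fixes q :: real and b :: "'a \<Rightarrow> complex"
  assumes "1 \<le> q" "finite F" "\<And>y. y \<in> F \<Longrightarrow> 0 \<le> w y" "(\<Sum>y\<in>F. w y) = 1"
  shows "norm (\<Sum>y\<in>F. w y *\<^sub>R b y) powr q \<le> (\<Sum>y\<in>F. w y * norm (b y) powr q)"
proof -
  define a where "a = (\<Sum>y\<in>F. w y * norm (b y))"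
  have a0: "0 \<le> a" unfolding a_def using assms by (intro sum_nonneg) auto
  have "norm (\<Sum>y\<in>F. w y *\<^sub>R b y) \<le> a"
    unfolding a_def by (rule order_trans[OF norm_sum]) (use assms in \<open>auto intro!: sum_mono\<close>)
  then have "norm (\<Sum>y\<in>F. w y *\<^sub>R b y) powr q \<le> a powr q"
    using assms(1) by (intro powr_mono2) auto
  also have "\<dots> \<le> (\<Sum>y\<in>F. w y * norm (b y) powr q)"
  proof (cases "a = 0")
    case True
    then show ?thesis using assms by (auto intro!: sum_nonneg)
  next
    case False
    then have a: "0 < a" using a0 by simp
    have *: "q * norm (b y) / a * a powr q \<le> norm (b y) powr q + (q - 1) * a powr q" for y
    proof -
      have "q * (norm (b y) / a) \<le> (norm (b y) / a) powr q + (q - 1)"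
        using powr_ge_tangent(1)[of q "norm (b y) / a"] assms(1) a by simp
      then have "q * (norm (b y) / a) * a powr q \<le> ((norm (b y) / a) powr q + (q - 1)) * a powr q"
        by (intro mult_right_mono) auto
      moreover have "(norm (b y) / a) powr q * a powr q = norm (b y) powr q"
        using a by (simp add: powr_divide)
      ultimately show ?thesis by (simp add: distrib_right)
    qed
    have "q * a powr q = (\<Sum>y\<in>F. w y * (q * norm (b y) / a * a powr q))"
    proof -
      have "(\<Sum>y\<in>F. w y * (q * norm (b y) / a * a powr q)) = (q * a powr q / a) * a"
        unfolding a_def sum_distrib_left by (intro sum.cong refl) (simp add: field_simps)
      then show ?thesis using a by simp
    qed
    also have "\<dots> \<le> (\<Sum>y\<in>F. w y * (norm (b y) powr q + (q - 1) * a powr q))"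
      using assms(3) * by (intro sum_mono mult_left_mono) auto
    also have "\<dots> = (\<Sum>y\<in>F. w y * norm (b y) powr q) + (q - 1) * a powr q"
      using assms(4) by (simp add: distrib_left sum.distrib flip: sum_distrib_right)
    finally show ?thesis by (simp add: algebra_simps)
  qed
  finally show ?thesis .
qed

text \<open>For \<open>a\<close> nonzero, \<open>powr_convexity_defect\<close> is applied at
  \<open>t = b y / a\<close>, multiplied by \<open>norm a powr q\<close> and averaged. The mean of
  \<open>b y / a\<close> is 1, which turns the averaged tangent gap into the Jensen gap.\<close>

lemma averaged_convexity_defect:
  fixes q \<delta> :: real
  assumes q: "1 < q" and \<delta>: "0 < \<delta>"
  obtains C where "1 \<le> C"
    "\<And>F w (b :: 'a \<Rightarrow> complex) a. finite F \<Longrightarrow> (\<And>y. y \<in> F \<Longrightarrow> 0 \<le> w y) \<Longrightarrow> (\<Sum>y\<in>F. w y) = 1 \<Longrightarrow>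
       a = (\<Sum>y\<in>F. w y *\<^sub>R b y) \<Longrightarrow>
       (\<Sum>y\<in>F. w y * norm (b y - a) powr q)
       \<le> \<delta> * (norm a powr q + (\<Sum>y\<in>F. w y * norm (b y) powr q))
         + C * ((\<Sum>y\<in>F. w y * norm (b y) powr q) - norm a powr q)"
proof -
  obtain C where C1: "1 \<le> C" and C: "\<And>t::complex. norm (t - 1) powr q
       \<le> \<delta> * (1 + norm t powr q) + C * (norm t powr q + (q - 1) - q * Re t)"
    using powr_convexity_defect[OF assms] by blast
  show ?thesis
  proof (rule that[OF C1])
    fix F and w :: "'a \<Rightarrow> real" and b :: "'a \<Rightarrow> complex" and a
    assume F: "finite F" and w: "\<And>y. y \<in> F \<Longrightarrow> 0 \<le> w y" and w1: "(\<Sum>y\<in>F. w y) = 1"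
      and a: "a = (\<Sum>y\<in>F. w y *\<^sub>R b y)"
    define B where "B = (\<Sum>y\<in>F. w y * norm (b y) powr q)"
    have B0: "0 \<le> B" unfolding B_def using w by (intro sum_nonneg) auto
    have "(\<Sum>y\<in>F. w y * norm (b y - a) powr q) \<le> \<delta> * (norm a powr q + B) + C * (B - norm a powr q)"
    proof (cases "a = 0")
      case True
      then have "(\<Sum>y\<in>F. w y * norm (b y - a) powr q) = B" by (simp add: B_def)
      \<comment> \<open>The case \<open>a = 0\<close> is the reason for recording
        \<open>1 \<le> C\<close>.\<close>
      also have "\<dots> \<le> C * B" using C1 B0 by (simp add: mult_le_cancel_right1)
      finally show ?thesis using True \<delta> B0 q by (simp add: add_increasing)
    next
      case False
      define A where "A = norm a powr q"
      have pt: "norm (b y - a) powr q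
          \<le> \<delta> * (A + norm (b y) powr q) + C * (norm (b y) powr q + (q - 1) * A - q * A * Re (b y / a))" for y
      proof -
        have "norm (b y / a - 1) powr q * A \<le> (\<delta> * (1 + norm (b y / a) powr q)
            + C * (norm (b y / a) powr q + (q - 1) - q * Re (b y / a))) * A"
          by (intro mult_right_mono C) (simp add: A_def)
        moreover have "norm (b y / a - 1) powr q * A = norm (b y - a) powr q"
        proof -
          have "b y / a - 1 = (b y - a) / a" using False by (simp add: field_simps)
          then show ?thesis using False by (simp add: A_def norm_divide powr_divide)
        qed
        moreover have "norm (b y / a) powr q * A = norm (b y) powr q"
          using False by (simp add: A_def norm_divide powr_divide)
        moreover have "(\<delta> * (1 + norm (b y / a) powr q)
            + C * (norm (b y / a) powr q + (q - 1) - q * Re (b y / a))) * A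
          = \<delta> * (A + norm (b y / a) powr q * A)
            + C * (norm (b y / a) powr q * A + (q - 1) * A - q * A * Re (b y / a))"
          by (simp add: algebra_simps)
        ultimately show ?thesis by metis
      qed
      have "(\<Sum>y\<in>F. w y * norm (b y - a) powr q) \<le> (\<Sum>y\<in>F. w y * (\<delta> * (A + norm (b y) powr q)
           + C * (norm (b y) powr q + (q - 1) * A - q * A * Re (b y / a))))"
        using w pt by (intro sum_mono mult_left_mono) auto
      also have "\<dots> = (\<Sum>y\<in>F. (\<delta> * A + C * (q - 1) * A) * w y + (\<delta> + C) * (w y * norm (b y) powr q)
          - C * q * A * (w y * Re (b y / a)))"
        by (intro sum.cong refl) (simp add: algebra_simps)
      also have "\<dots> = (\<delta> * A + C * (q - 1) * A) * 1 + (\<delta> + C) * B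
          - C * q * A * (\<Sum>y\<in>F. w y * Re (b y / a))"
        unfolding B_def w1[symmetric] by (simp add: sum.distrib sum_subtractf sum_distrib_left)
      also have "(\<Sum>y\<in>F. w y * Re (b y / a)) = 1"
      proof -
        have "(\<Sum>y\<in>F. w y *\<^sub>R (b y / a)) = (\<Sum>y\<in>F. w y *\<^sub>R b y) / a"
          unfolding sum_divide_distrib by (simp add: scaleR_conv_of_real)
        then have "(\<Sum>y\<in>F. w y *\<^sub>R (b y / a)) = 1"
          using False by (simp flip: a)
        then have "Re (\<Sum>y\<in>F. w y *\<^sub>R (b y / a)) = 1" by simp
        then show ?thesis by simp
      qed
      finally show ?thesis by (simp add: A_def algebra_simps)
    qed
    then show "(\<Sum>y\<in>F. w y * norm (b y - a) powr q)
       \<le> \<delta> * (norm a powr q + (\<Sum>y\<in>F. w y * norm (b y) powr q))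
         + C * ((\<Sum>y\<in>F. w y * norm (b y) powr q) - norm a powr q)"
      by (simp add: B_def)
  qed
qed

section \<open>Norm bounds on \<open>L\<^sup>q\<close>\<close>

text \<open>Includes membership in \<open>L\<^sup>q\<close>. Stated with finite partial sums, so that no summability has to
  be carried along.\<close>

definition lq_le :: "('a \<Rightarrow> real) \<Rightarrow> ereal \<Rightarrow> real \<Rightarrow> ('a \<Rightarrow> complex) \<Rightarrow> bool" where
  "lq_le m q C f \<longleftrightarrow> 0 \<le> C \<and> (if q = \<infinity> then \<forall>x. norm (f x) \<le> C
     else \<forall>F. finite F \<longrightarrow>
       (\<Sum>x\<in>F. norm (f x) powr real_of_ereal q * m x) \<le> C powr real_of_ereal q)"

lemma lq_le_ereal:
  "lq_le m (ereal p) C f \<longleftrightarrow>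
     0 \<le> C \<and> (\<forall>F. finite F \<longrightarrow> (\<Sum>x\<in>F. norm (f x) powr p * m x) \<le> C powr p)"
  by (simp add: lq_le_def)

lemma lq_le_infty: "lq_le m \<infinity> C f \<longleftrightarrow> 0 \<le> C \<and> (\<forall>x. norm (f x) \<le> C)"
  by (simp add: lq_le_def)

lemma lq_exponent_cases:
  assumes "1 \<le> (q::ereal)"
  obtains "q = \<infinity>" | p where "q = ereal p" "1 \<le> p"
  using assms by (cases q) auto

lemma jensen_powr_two:
  fixes u v :: complex
  assumes "1 \<le> p" "0 \<le> s" "0 \<le> t" "s + t = 1"
  shows "norm (s *\<^sub>R u + t *\<^sub>R v) powr p \<le> s * norm u powr p + t * norm v powr p"
  using complex_jensen_powr[of p UNIV "\<lambda>b. if b then s else t" "\<lambda>b. if b then u else v"] assms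
  by (simp add: UNIV_bool add.commute)

locale lq_space =
  fixes m :: "'a \<Rightarrow> real" and q :: ereal
  assumes m_pos: "0 < m x" and q_ge1: "1 \<le> q"
begin

lemma lq_le_nonneg: "lq_le m q C f \<Longrightarrow> 0 \<le> C"
  by (simp add: lq_le_def)

lemma lq_le_mono:
  assumes "lq_le m q C f" "C \<le> C'"
  shows "lq_le m q C' f"
  using q_ge1
proof (cases rule: lq_exponent_cases)
  case 1
  then show ?thesis using assms by (auto simp: lq_le_infty intro: order_trans)
next
  case (2 p)
  have "C powr p \<le> C' powr p" using assms 2 by (intro powr_mono2) (auto simp: lq_le_def)
  moreover have "0 \<le> C'" using assms by (simp add: lq_le_def)
  ultimately show ?thesis using assms 2 by (auto simp: lq_le_ereal intro: order_trans)
qed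

lemma lq_le_Lq_norm:
  assumes "f \<in> Lq m q"
  shows "lq_le m q (Lq_norm m q f) f"
  using q_ge1
proof (cases rule: lq_exponent_cases)
  case 1
  then have "bounded (range f)" using assms by (simp add: Lq_def)
  then have bdd: "bdd_above (range (\<lambda>x. norm (f x)))"
    by (auto simp: bounded_iff bdd_above_def)
  then have "norm (f x) \<le> Lq_norm m q f" for x
    using 1 by (auto simp: Lq_norm_def intro: cSUP_upper)
  moreover then have "0 \<le> Lq_norm m q f" by (meson norm_ge_zero order_trans)
  ultimately show ?thesis using 1 by (simp add: lq_le_infty)
next
  case (2 p)
  let ?I = "\<Sum>\<^sub>\<infinity>x. norm (f x) powr p * m x"
  have s: "(\<lambda>x. norm (f x) powr p * m x) summable_on UNIV" using assms 2 by (simp add: Lq_def)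
  have "0 \<le> ?I" using m_pos by (intro infsum_nonneg) (auto simp: less_imp_le)
  then have "Lq_norm m q f powr p = ?I" using 2 by (simp add: Lq_norm_def powr_powr)
  moreover have "(\<Sum>x\<in>F. norm (f x) powr p * m x) \<le> ?I" if "finite F" for F
    using that m_pos by (intro finite_sum_le_infsum s) (auto simp: less_imp_le)
  ultimately show ?thesis using 2 by (simp add: lq_le_ereal Lq_norm_def)
qed

lemma lq_leD:
  assumes "lq_le m q C f"
  shows "f \<in> Lq m q" "Lq_norm m q f \<le> C"
proof -
  have "f \<in> Lq m q \<and> Lq_norm m q f \<le> C"
    using q_ge1
  proof (cases rule: lq_exponent_cases)
    case 1
    then show ?thesis
      using assms by (auto simp: lq_le_infty Lq_def Lq_norm_def bounded_iff intro!: cSUP_least)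
  next
    case (2 p)
    have s: "(\<lambda>x. norm (f x) powr p * m x) summable_on UNIV"
      using assms 2 m_pos
      by (intro nonneg_bdd_above_summable_on bdd_aboveI2[where M = "C powr p"])
        (auto simp: lq_le_ereal less_imp_le)
    have "(\<Sum>\<^sub>\<infinity>x. norm (f x) powr p * m x) \<le> C powr p"
      using assms 2 by (intro infsum_le_finite_sums s) (auto simp: lq_le_ereal)
    then have "(\<Sum>\<^sub>\<infinity>x. norm (f x) powr p * m x) powr (1 / p) \<le> (C powr p) powr (1 / p)"
      using 2 m_pos by (intro powr_mono2 infsum_nonneg) (auto simp: less_imp_le)
    then show ?thesis
      using 2 s assms by (simp add: Lq_def Lq_norm_def powr_powr lq_le_ereal)
  qed
  then show "f \<in> Lq m q" "Lq_norm m q f \<le> C" by auto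
qed

lemma lq_le_zero: "lq_le m q 0 (\<lambda>x. 0)"
  by (auto simp: lq_le_def)

lemma lq_le_norm_le:
  assumes "lq_le m q C g" "\<And>x. norm (f x) \<le> norm (g x)"
  shows "lq_le m q C f"
  using q_ge1
proof (cases rule: lq_exponent_cases)
  case 1
  then show ?thesis using assms order_trans by (fastforce simp: lq_le_infty)
next
  case (2 p)
  have "(\<Sum>x\<in>F. norm (f x) powr p * m x) \<le> (\<Sum>x\<in>F. norm (g x) powr p * m x)" for F
    using assms(2) 2 m_pos by (intro sum_mono mult_right_mono powr_mono2) (auto simp: less_imp_le)
  then show ?thesis using assms(1) 2 by (auto simp: lq_le_ereal intro: order_trans)
qed

lemma lq_le_cmult:
  assumes "lq_le m q C f"
  shows "lq_le m q (norm c * C) (\<lambda>x. c * f x)"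
  using q_ge1
proof (cases rule: lq_exponent_cases)
  case 1
  then show ?thesis using assms by (auto simp: lq_le_infty norm_mult mult_left_mono)
next
  case (2 p)
  have "(\<Sum>x\<in>F. norm (c * f x) powr p * m x) = norm c powr p * (\<Sum>x\<in>F. norm (f x) powr p * m x)" for F
    by (simp add: norm_mult powr_mult sum_distrib_left mult.assoc)
  then show ?thesis using assms 2 by (auto simp: lq_le_ereal powr_mult intro!: mult_left_mono)
qed

text \<open>Minkowski's inequality. The sum \<open>f + g\<close> is the convex combination, with
  weights \<open>A / (A + B)\<close> and \<open>B / (A + B)\<close>, of multiples of
  \<open>f\<close> and \<open>g\<close> that both have bound \<open>A + B\<close>; convexity of the
  power is then summed over \<open>F\<close>. If \<open>A\<close> or \<open>B\<close> vanishes, the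
  corresponding function is zero.\<close>

lemma lq_le_add:
  assumes f: "lq_le m q A f" and g: "lq_le m q B g"
  shows "lq_le m q (A + B) (\<lambda>x. f x + g x)"
  using q_ge1
proof (cases rule: lq_exponent_cases)
  case 1
  then show ?thesis
    using f g by (auto simp: lq_le_infty intro!: order_trans[OF norm_triangle_ineq] add_mono)
next
  case (2 p)
  have zero: "h x = 0" if "lq_le m q 0 h" for h x
  proof -
    have "norm (h x) powr p * m x \<le> 0"
      using that 2 spec[where x = "{x}" and P = "\<lambda>F. finite F \<longrightarrow> (\<Sum>x\<in>F. norm (h x) powr p * m x) \<le> 0"]
      by (simp add: lq_le_ereal)
    then show ?thesis using m_pos[of x] by (simp add: mult_le_0_iff)
  qed
  have nn: "0 \<le> A" "0 \<le> B" using f g lq_le_nonneg by auto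
  show ?thesis
  proof (cases "A = 0 \<or> B = 0")
    case True
    then show ?thesis using zero[of f] zero[of g] f g by auto
  next
    case False
    then have AB: "0 < A" "0 < B" "0 < A + B" using nn by auto
    have pt: "norm (f x + g x) powr p
        \<le> (A + B) powr p * (A / (A + B) * (norm (f x) powr p / A powr p)
            + B / (A + B) * (norm (g x) powr p / B powr p))" for x
    proof -
      have "norm ((A / (A + B)) *\<^sub>R (((A + B) / A) *\<^sub>R f x) + (B / (A + B)) *\<^sub>R (((A + B) / B) *\<^sub>R g x)) powr p
        \<le> A / (A + B) * norm (((A + B) / A) *\<^sub>R f x) powr p
          + B / (A + B) * norm (((A + B) / B) *\<^sub>R g x) powr p"
        using AB 2 by (intro jensen_powr_two) (auto simp flip: add_divide_distrib)
      moreover have "norm (((A + B) / A) *\<^sub>R f x) powr p = (A + B) powr p * (norm (f x) powr p / A powr p)"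
        "norm (((A + B) / B) *\<^sub>R g x) powr p = (A + B) powr p * (norm (g x) powr p / B powr p)"
        using AB by (simp_all add: powr_mult powr_divide)
      moreover have "(A / (A + B)) *\<^sub>R (((A + B) / A) *\<^sub>R f x) + (B / (A + B)) *\<^sub>R (((A + B) / B) *\<^sub>R g x) = f x + g x"
        using AB by simp
      ultimately have "norm (f x + g x) powr p
          \<le> A / (A + B) * ((A + B) powr p * (norm (f x) powr p / A powr p))
            + B / (A + B) * ((A + B) powr p * (norm (g x) powr p / B powr p))" by metis
      then show ?thesis by (simp only: distrib_left mult_ac)
    qed
    have "(\<Sum>x\<in>F. norm (f x + g x) powr p * m x) \<le> (A + B) powr p" if "finite F" for F
    proof -
      have "(\<Sum>x\<in>F. norm (f x + g x) powr p * m x)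
          \<le> (\<Sum>x\<in>F. (A + B) powr p * (A / (A + B) * (norm (f x) powr p / A powr p)
            + B / (A + B) * (norm (g x) powr p / B powr p)) * m x)"
        using pt m_pos by (intro sum_mono mult_right_mono) (auto simp: less_imp_le)
      also have "\<dots> = (A + B) powr p * (A / (A + B) * ((\<Sum>x\<in>F. norm (f x) powr p * m x) / A powr p)
            + B / (A + B) * ((\<Sum>x\<in>F. norm (g x) powr p * m x) / B powr p))"
        by (simp add: sum_distrib_left sum_divide_distrib flip: sum.distrib)
          (intro sum.cong refl, simp add: algebra_simps)
      also have "\<dots> \<le> (A + B) powr p * (A / (A + B) * 1 + B / (A + B) * 1)"
        using f g that 2 AB
        by (intro mult_left_mono add_mono) (auto simp: lq_le_ereal field_simps)
      also have "\<dots> = (A + B) powr p" using AB by (simp flip: add_divide_distrib)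
      finally show ?thesis .
    qed
    then show ?thesis using 2 nn by (simp add: lq_le_ereal)
  qed
qed

lemma lq_le_diff:
  assumes "lq_le m q A f" "lq_le m q B g"
  shows "lq_le m q (A + B) (\<lambda>x. f x - g x)"
  using lq_le_add[OF assms(1) lq_le_cmult[OF assms(2), of "-1"]] by simp

lemma lq_le_sum:
  assumes "finite I" "\<And>i. i \<in> I \<Longrightarrow> lq_le m q (A i) (f i)"
  shows "lq_le m q (\<Sum>i\<in>I. A i) (\<lambda>x. \<Sum>i\<in>I. f i x)"
  using assms by (induction I) (auto simp: lq_le_zero lq_le_add)

text \<open>A form of Fatou's lemma: each finite partial sum passes to the limit.\<close>

lemma lq_le_limit:
  assumes "\<And>n. lq_le m q C (f n)" "\<And>x. (\<lambda>n. f n x) \<longlonglongrightarrow> g x"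
  shows "lq_le m q C g"
  using q_ge1
proof (cases rule: lq_exponent_cases)
  case 1
  then have "norm (g x) \<le> C" for x
    using assms(1) by (intro LIMSEQ_le_const2[OF tendsto_norm[OF assms(2)]]) (auto simp: lq_le_infty)
  then show ?thesis using 1 assms(1) by (auto simp: lq_le_infty)
next
  case (2 p)
  have "(\<Sum>x\<in>F. norm (g x) powr p * m x) \<le> C powr p" if "finite F" for F
  proof (rule LIMSEQ_le_const2)
    show "(\<lambda>n. \<Sum>x\<in>F. norm (f n x) powr p * m x) \<longlonglongrightarrow> (\<Sum>x\<in>F. norm (g x) powr p * m x)"
      using 2 by (intro tendsto_intros tendsto_powr2 assms(2)) auto
    show "\<exists>N. \<forall>n\<ge>N. (\<Sum>x\<in>F. norm (f n x) powr p * m x) \<le> C powr p"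
      using assms(1) 2 that by (auto simp: lq_le_ereal)
  qed
  then show ?thesis using 2 assms(1) by (auto simp: lq_le_ereal)
qed

text \<open>Every point has positive mass, so evaluation at \<open>x\<close> is bounded on
  \<open>Lq\<close>. The constant depends on \<open>x\<close> alone, which gives pointwise
  convergence of norm-convergent series.\<close>

lemma lq_le_pointwise:
  obtains K where "\<And>C f. lq_le m q C f \<Longrightarrow> norm (f x) \<le> K * C"
  using q_ge1
proof (cases rule: lq_exponent_cases)
  case 1
  then show ?thesis using that[of 1] by (simp add: lq_le_infty)
next
  case (2 p)
  have "norm (f x) \<le> (1 / m x powr (1 / p)) * C" if "lq_le m q C f" for C f
  proof -
    have "norm (f x) powr p * m x \<le> C powr p"
    proof -
      have "(\<Sum>x\<in>{x}. norm (f x) powr p * m x) \<le> C powr p"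
        using that unfolding 2 lq_le_ereal by blast
      then show ?thesis by simp
    qed
    then have "(norm (f x) powr p * m x) powr (1 / p) \<le> (C powr p) powr (1 / p)"
      using 2 m_pos by (intro powr_mono2) (auto simp: less_imp_le)
    then have "norm (f x) * m x powr (1 / p) \<le> C"
      using 2 m_pos[of x] lq_le_nonneg[OF that] by (simp add: powr_mult powr_powr)
    then show ?thesis using m_pos[of x] by (simp add: field_simps)
  qed
  then show ?thesis by (rule that)
qed

end

section \<open>Reversible Markov kernels\<close>

text \<open>Polymorphic in the values: complex for the operator itself, real for densities such as
  \<open>norm (f y) powr p\<close>.\<close>

definition avg :: "('a \<Rightarrow> 'a \<Rightarrow> real) \<Rightarrow> ('a \<Rightarrow> 'b::real_vector) \<Rightarrow> 'a \<Rightarrow> 'b" where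
  "avg R f x = (\<Sum>y | R x y \<noteq> 0. R x y *\<^sub>R f y)"

lemma avg_eq_sum:
  assumes "finite F" "\<And>y. R x y \<noteq> 0 \<Longrightarrow> y \<in> F"
  shows "avg R f x = (\<Sum>y\<in>F. R x y *\<^sub>R f y)"
  unfolding avg_def using assms by (intro sum.mono_neutral_left) auto

lemma avg_add: "avg R (\<lambda>x. f x + g x) = (\<lambda>x. avg R f x + avg R g x)"
  by (simp add: avg_def fun_eq_iff scaleR_add_right sum.distrib)

lemma avg_diff: "avg R (\<lambda>x. f x - g x) = (\<lambda>x. avg R f x - avg R g x)"
  by (simp add: avg_def fun_eq_iff scaleR_diff_right sum_subtractf)

lemma avg_cmult: "avg R (\<lambda>x. c * f x) = (\<lambda>x. c * avg R f x)"
  for f :: "'a \<Rightarrow> 'b::real_algebra"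
  by (simp add: avg_def fun_eq_iff sum_distrib_left)

lemma funpow_avg_diff:
  "(avg R ^^ n) (\<lambda>x. f x - g x) = (\<lambda>x. (avg R ^^ n) f x - (avg R ^^ n) g x)"
  by (induction n) (simp_all add: avg_diff)

text \<open>Besides the random walk itself, its powers and the kernels left after splitting off a
  multiple of the identity are instances, so each result below is available for all of them.\<close>

locale rev_markov =
  fixes m :: "'a \<Rightarrow> real" and R :: "'a \<Rightarrow> 'a \<Rightarrow> real"
  assumes meas_pos: "0 < m x"
    and kernel_nonneg: "0 \<le> R x y"
    and finite_row: "finite {y. R x y \<noteq> 0}"
    and row_sum: "(\<Sum>y | R x y \<noteq> 0. R x y) = 1"
    and reversible: "m x * R x y = m y * R y x"
begin

lemma kernel_zero_sym: "R x y = 0 \<longleftrightarrow> R y x = 0"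
  using reversible[of x y] meas_pos[of x] meas_pos[of y] by auto

lemma sum_row_le: "finite F \<Longrightarrow> (\<Sum>y\<in>F. R x y) \<le> 1"
proof -
  assume "finite F"
  have "(\<Sum>y\<in>F. R x y) = (\<Sum>y\<in>F \<inter> {y. R x y \<noteq> 0}. R x y)"
    using \<open>finite F\<close> by (intro sum.mono_neutral_right) auto
  also have "\<dots> \<le> (\<Sum>y | R x y \<noteq> 0. R x y)"
    using kernel_nonneg finite_row by (intro sum_mono2) auto
  finally show ?thesis using row_sum by simp
qed

lemma avg_one: "avg R (\<lambda>x. 1::real) = (\<lambda>x. 1)"
  by (simp add: avg_def row_sum fun_eq_iff)

text \<open>Self-adjointness of \<open>avg R\<close> tested against the indicator of
  \<open>F\<close>; \<open>G\<close> has to contain all points reached from \<open>F\<close> in one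
  step.\<close>

lemma sum_avg_eq:
  fixes g :: "'a \<Rightarrow> real"
  assumes "finite F" "finite G" "\<And>x y. x \<in> F \<Longrightarrow> R x y \<noteq> 0 \<Longrightarrow> y \<in> G"
  shows "(\<Sum>x\<in>F. m x * avg R g x) = (\<Sum>y\<in>G. m y * g y * (\<Sum>x\<in>F. R y x))"
proof -
  have "(\<Sum>x\<in>F. m x * avg R g x) = (\<Sum>x\<in>F. \<Sum>y\<in>G. m x * R x y * g y)"
    using assms by (intro sum.cong refl) (simp add: avg_eq_sum[of G] sum_distrib_left mult.assoc)
  also have "\<dots> = (\<Sum>y\<in>G. \<Sum>x\<in>F. m y * R y x * g y)"
    by (subst sum.swap) (simp only: reversible)
  also have "\<dots> = (\<Sum>y\<in>G. m y * g y * (\<Sum>x\<in>F. R y x))"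
    by (simp add: sum_distrib_left mult_ac)
  finally show ?thesis .
qed

text \<open>Reversibility makes \<open>m\<close> invariant: after transposition each point of
  \<open>G\<close> is counted with a partial row sum, which is at most 1.\<close>

lemma sum_avg_le:
  fixes g :: "'a \<Rightarrow> real"
  assumes "\<And>x. 0 \<le> g x" "\<And>F. finite F \<Longrightarrow> (\<Sum>x\<in>F. m x * g x) \<le> K" "finite F"
  shows "(\<Sum>x\<in>F. m x * avg R g x) \<le> K"
proof -
  define G where "G = (\<Union>x\<in>F. {y. R x y \<noteq> 0})"
  have G: "finite G" using assms(3) finite_row by (auto simp: G_def)
  have "(\<Sum>x\<in>F. m x * avg R g x) = (\<Sum>y\<in>G. m y * g y * (\<Sum>x\<in>F. R y x))"
    using assms(3) G by (intro sum_avg_eq) (auto simp: G_def)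
  also have "\<dots> \<le> (\<Sum>y\<in>G. m y * g y)"
    using assms meas_pos sum_row_le kernel_nonneg
    by (intro sum_mono mult_left_le) (auto simp: less_imp_le)
  also have "\<dots> \<le> K" using assms(2) G by simp
  finally show ?thesis .
qed

lemma avg_jensen:
  "1 \<le> p \<Longrightarrow> norm (avg R f x) powr p \<le> avg R (\<lambda>y. norm (f y) powr p) x"
  for f :: "'a \<Rightarrow> complex"
  unfolding avg_def real_scaleR_def
  using kernel_nonneg finite_row row_sum by (intro complex_jensen_powr) auto

text \<open>Contraction on every \<open>Lq\<close>: for finite exponents by Jensen's inequality in
  each row followed by invariance of \<open>m\<close>.\<close>

lemma lq_le_avg:
  assumes "1 \<le> q" "lq_le m q C f"
  shows "lq_le m q C (avg R f)"
  using assms(1)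
proof (cases rule: lq_exponent_cases)
  case 1
  have "norm (avg R f x) \<le> C" for x
  proof -
    have "norm (avg R f x) \<le> (\<Sum>y | R x y \<noteq> 0. R x y * norm (f y))"
      unfolding avg_def using kernel_nonneg by (intro order_trans[OF norm_sum]) auto
    also have "\<dots> \<le> (\<Sum>y | R x y \<noteq> 0. R x y * C)"
      using assms(2) 1 kernel_nonneg by (intro sum_mono mult_left_mono) (auto simp: lq_le_infty)
    also have "\<dots> = C" using row_sum by (simp flip: sum_distrib_right)
    finally show ?thesis .
  qed
  then show ?thesis using 1 assms(2) by (simp add: lq_le_infty)
next
  case (2 p)
  have "(\<Sum>x\<in>F. norm (avg R f x) powr p * m x) \<le> C powr p" if "finite F" for F
  proof -
    have "(\<Sum>x\<in>F. norm (avg R f x) powr p * m x) \<le> (\<Sum>x\<in>F. m x * avg R (\<lambda>y. norm (f y) powr p) x)"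
      using avg_jensen 2 meas_pos by (intro sum_mono) (auto simp: mult.commute less_imp_le intro!: mult_left_mono)
    also have "\<dots> \<le> C powr p"
      using assms(2) 2 that by (intro sum_avg_le) (auto simp: lq_le_ereal mult.commute)
    finally show ?thesis .
  qed
  then show ?thesis using 2 assms(2) by (simp add: lq_le_ereal)
qed

lemma lq_le_funpow_avg:
  assumes "1 \<le> q" "lq_le m q C f"
  shows "lq_le m q C ((avg R ^^ n) f)"
  by (induction n) (use assms lq_le_avg in auto)

end

text \<open>The \<open>k\<close>-step transition probability from \<open>x\<close> to
  \<open>y\<close>, taken with respect to counting measure and obtained by applying the operator to
  a point indicator.\<close>

definition kpow :: "('a \<Rightarrow> 'a \<Rightarrow> real) \<Rightarrow> nat \<Rightarrow> 'a \<Rightarrow> 'a \<Rightarrow> real" where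
  "kpow R k x y = (avg R ^^ k) (\<lambda>z. of_bool (z = y)) x"

context rev_markov
begin

lemma kpow_0: "kpow R 0 x y = of_bool (x = y)"
  by (simp add: kpow_def)

lemma kpow_Suc: "kpow R (Suc k) x y = avg R (\<lambda>z. kpow R k z y) x"
  by (simp add: kpow_def)

lemma kpow_1: "kpow R (Suc 0) x y = R x y"
  using finite_row[of x] avg_eq_sum[of "insert y {z. R x z \<noteq> 0}" R x "\<lambda>z. of_bool (z = y) :: real"]
  by (simp add: kpow_def of_bool_def if_distrib sum.delta cong: if_cong)

lemma kpow_nonneg: "0 \<le> kpow R k x y"
  by (induction k arbitrary: x)
    (auto simp: kpow_0 kpow_Suc avg_def kernel_nonneg intro!: sum_nonneg)

lemma kpow_Suc_nonzero:
  assumes "kpow R (Suc k) x y \<noteq> 0"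
  obtains z where "R x z \<noteq> 0" "kpow R k z y \<noteq> 0"
proof -
  have "\<exists>z. R x z \<noteq> 0 \<and> kpow R k z y \<noteq> 0"
  proof (rule ccontr)
    assume "\<not> ?thesis"
    then have "kpow R (Suc k) x y = 0" unfolding kpow_Suc avg_def by (intro sum.neutral) auto
    then show False using assms by simp
  qed
  then show ?thesis using that by blast
qed

lemma finite_kpow_row: "finite {y. kpow R k x y \<noteq> 0}"
proof (induction k arbitrary: x)
  case (Suc k)
  have "{y. kpow R (Suc k) x y \<noteq> 0} \<subseteq> (\<Union>z\<in>{z. R x z \<noteq> 0}. {y. kpow R k z y \<noteq> 0})"
    by (auto elim: kpow_Suc_nonzero)
  then show ?case using Suc finite_row by (meson finite_UN_I finite_subset)
qed (simp add: kpow_0)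

text \<open>Identifies the iterated operator with the operator of one kernel, so that statements
  about arbitrary kernels apply to powers. In the induction step all rows involved lie in one finite
  set \<open>G\<close>, and the sums can be interchanged.\<close>

lemma avg_kpow: "avg (kpow R k) f = (avg R ^^ k) f"
  for f :: "'a \<Rightarrow> 'b::real_vector"
proof (induction k)
  case 0
  have "avg (kpow R 0) f x = f x" for x
    by (subst avg_eq_sum[of "{x}"]) (auto simp: kpow_0)
  then show ?case by auto
next
  case (Suc k)
  show ?case
  proof
    fix x
    define G where "G = (\<Union>z\<in>{z. R x z \<noteq> 0}. {y. kpow R k z y \<noteq> 0})"
    have G: "finite G" using finite_row finite_kpow_row by (auto simp: G_def)
    have sub: "y \<in> G" if "kpow R (Suc k) x y \<noteq> 0" for y
      using that by (auto simp: G_def elim: kpow_Suc_nonzero)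
    have "(avg R ^^ Suc k) f x = avg R (avg (kpow R k) f) x" by (simp add: Suc)
    also have "\<dots> = (\<Sum>z | R x z \<noteq> 0. R x z *\<^sub>R (\<Sum>y\<in>G. kpow R k z y *\<^sub>R f y))"
      unfolding avg_def[of R]
      by (intro sum.cong refl arg_cong[where f = "scaleR _"] avg_eq_sum G) (auto simp: G_def)
    also have "\<dots> = (\<Sum>y\<in>G. (\<Sum>z | R x z \<noteq> 0. R x z * kpow R k z y) *\<^sub>R f y)"
      by (simp add: scaleR_sum_right scaleR_sum_left sum.swap[of _ G])
    also have "\<dots> = avg (kpow R (Suc k)) f x"
      using G sub by (subst avg_eq_sum[of G]) (auto simp: kpow_Suc avg_def)
    finally show "avg (kpow R (Suc k)) f x = (avg R ^^ Suc k) f x" by simp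
  qed
qed

lemma kpow_reversible: "m x * kpow R k x y = m y * kpow R k y x"
proof (induction k arbitrary: x y)
  case 0
  then show ?case by (auto simp: kpow_0)
next
  case (Suc k)
  have "m x * kpow R (Suc k) x y = (\<Sum>z | R x z \<noteq> 0. m x * R x z * kpow R k z y)"
    by (simp add: kpow_Suc avg_def sum_distrib_left mult.assoc)
  also have "\<dots> = (\<Sum>z | R x z \<noteq> 0. m y * (kpow R k y z * R z x))"
  proof (intro sum.cong refl)
    fix z
    have "m x * R x z * kpow R k z y = R z x * (m z * kpow R k z y)" by (simp add: reversible[of x z])
    also have "\<dots> = m y * (kpow R k y z * R z x)" by (simp add: Suc.IH[of z y])
    finally show "m x * R x z * kpow R k z y = m y * (kpow R k y z * R z x)" .
  qed
  also have "\<dots> = m y * (\<Sum>z\<in>{z. R x z \<noteq> 0} \<union> {z. kpow R k y z \<noteq> 0}. kpow R k y z * R z x)"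
    unfolding sum_distrib_left using finite_row finite_kpow_row
    by (intro sum.mono_neutral_left) (auto simp: kernel_zero_sym[of _ x])
  also have "(\<Sum>z\<in>{z. R x z \<noteq> 0} \<union> {z. kpow R k y z \<noteq> 0}. kpow R k y z * R z x)
      = avg (kpow R k) (\<lambda>z. R z x) y"
    using finite_row finite_kpow_row by (subst avg_eq_sum) auto
  \<comment> \<open>Reversal has turned the first step of the walk into the last one;
    \<open>funpow_swap1\<close> moves it to the front again.\<close>
  also have "\<dots> = (avg R ^^ k) (\<lambda>z. kpow R (Suc 0) z x) y" by (simp add: avg_kpow kpow_1)
  also have "\<dots> = kpow R (Suc k) y x" by (simp add: kpow_def funpow_swap1)
  finally show ?case .
qed

lemma rev_markov_kpow: "rev_markov m (kpow R k)"
proof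
  fix x
  have "(avg R ^^ k) (\<lambda>x. 1::real) = (\<lambda>x. 1)" by (induction k) (auto simp: avg_one)
  then have "avg (kpow R k) (\<lambda>x. 1::real) x = 1" by (simp add: avg_kpow)
  then show "(\<Sum>y | kpow R k x y \<noteq> 0. kpow R k x y) = 1" by (simp add: avg_def)
qed (use meas_pos kpow_nonneg finite_kpow_row kpow_reversible in auto)

text \<open>All terms are nonnegative, so a single \<open>E\<close>-path, whose steps each have
  probability at least \<open>e\<close>, gives the bound.\<close>

lemma kpow_ge:
  assumes "\<And>y z. E y z \<Longrightarrow> e \<le> R y z" "0 \<le> e" "(E ^^ n) x y"
  shows "e ^ n \<le> kpow R n x y"
  using assms(3)
proof (induction n arbitrary: x)
  case 0
  then show ?case by (simp add: kpow_0)
next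
  case (Suc n)
  obtain z where z: "E x z" "(E ^^ n) z y" using Suc.prems by (rule relpowp_Suc_E2)
  have "e ^ Suc n \<le> R x z * kpow R n z y"
    using assms(1)[OF z(1)] assms(2) Suc.IH[OF z(2)] by (auto intro!: mult_mono)
  also have "\<dots> = (\<Sum>w\<in>{z}. R x w *\<^sub>R kpow R n w y)" by simp
  also have "\<dots> \<le> (\<Sum>w\<in>insert z {w. R x w \<noteq> 0}. R x w *\<^sub>R kpow R n w y)"
    using finite_row kernel_nonneg kpow_nonneg by (intro sum_mono2) auto
  also have "\<dots> = kpow R (Suc n) x y"
    unfolding kpow_Suc using finite_row by (subst avg_eq_sum) auto
  finally show ?case .
qed

text \<open>Subtracting \<open>e\<close> on the diagonal and dividing by \<open>1 - e\<close> keeps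
  nonnegativity, row sums and reversibility.\<close>

lemma remove_diagonal:
  assumes e: "0 < e" "e < 1" and diag: "\<And>x. e \<le> R x x"
  obtains Q where "rev_markov m Q"
    "\<And>f x. avg R f x = of_real e * f x + of_real (1 - e) * (avg Q f x :: complex)"
proof
  define Q where "Q x y = (R x y - (if x = y then e else 0)) / (1 - e)" for x y
  \<comment> \<open>The inclusion may be proper: the diagonal entry of \<open>Q\<close> vanishes
    where \<open>R x x = e\<close>.\<close>
  have rows: "{y. Q x y \<noteq> 0} \<subseteq> {y. R x y \<noteq> 0}" for x
    using diag[of x] e by (auto simp: Q_def split: if_splits)
  have sum1: "(\<Sum>y | Q x y \<noteq> 0. Q x y *\<^sub>R g y) = (\<Sum>y | R x y \<noteq> 0. Q x y *\<^sub>R g y)"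
    for x and g :: "'a \<Rightarrow> 'b::real_vector"
    using rows finite_row by (intro sum.mono_neutral_left) auto
  have x_in: "x \<in> {y. R x y \<noteq> 0}" for x using diag[of x] e by auto
  show "rev_markov m Q"
  proof
    fix x y
    show "0 \<le> Q x y" using diag[of x] kernel_nonneg e by (auto simp: Q_def)
    show "finite {y. Q x y \<noteq> 0}" using rows finite_row by (rule finite_subset)
    show "m x * Q x y = m y * Q y x"
      using reversible[of x y] by (auto simp: Q_def algebra_simps)
    have "(\<Sum>y | Q x y \<noteq> 0. Q x y) = (\<Sum>y | R x y \<noteq> 0. Q x y)" using sum1[of x "\<lambda>_. 1::real"] by simp
    also have "\<dots> = ((\<Sum>y | R x y \<noteq> 0. R x y) - (\<Sum>y | R x y \<noteq> 0. if x = y then e else 0)) / (1 - e)"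
      by (simp add: Q_def sum_subtractf flip: sum_divide_distrib)
    also have "\<dots> = 1" using e x_in finite_row by (simp add: row_sum sum.delta')
    finally show "(\<Sum>y | Q x y \<noteq> 0. Q x y) = 1" .
  qed (rule meas_pos)
  fix f :: "'a \<Rightarrow> complex" and x
  have "of_real (1 - e) * avg Q f x = (\<Sum>y | R x y \<noteq> 0. R x y *\<^sub>R f y - (if x = y then e *\<^sub>R f y else 0))"
    unfolding avg_def sum1 sum_distrib_left
    using e by (intro sum.cong refl) (auto simp: Q_def scaleR_conv_of_real field_simps)
  also have "\<dots> = avg R f x - e *\<^sub>R f x"
    using x_in finite_row by (simp add: avg_def sum_subtractf sum.delta')
  finally show "avg R f x = of_real e * f x + of_real (1 - e) * avg Q f x"
    by (simp add: scaleR_conv_of_real)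
qed

end

section \<open>Analyticity of the square\<close>

lemma (in rev_markov) lq_space: "1 \<le> q \<Longrightarrow> lq_space m q"
  using meas_pos by unfold_locales

lemma funpow_add_apply: "(f ^^ (a + b)) x = (f ^^ a) ((f ^^ b) x)"
  by (simp add: funpow_add)

text \<open>By reversibility \<open>f - R R f\<close> at \<open>y\<close> is the average of \<open>f y - R f x\<close> over the same pairs \<open>(x, y)\<close>
  on which the convexity defect of the average \<open>R f x\<close> is measured. That \<open>C\<close> does not depend on \<open>R\<close>
  is what matters: the inequality is applied to all powers of one kernel.\<close>

lemma energy_inequality:
  fixes p \<delta> :: real
  assumes p: "1 < p" and \<delta>: "0 < \<delta>"
  obtains C where "1 \<le> C"
    "\<And>m R (f :: 'a \<Rightarrow> complex) F. rev_markov m R \<Longrightarrow> f \<in> Lq m (ereal p) \<Longrightarrow> finite F \<Longrightarrow>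
      (\<Sum>y\<in>F. norm (f y - avg R (avg R f) y) powr p * m y)
      \<le> 2 * \<delta> * (\<Sum>\<^sub>\<infinity>x. norm (f x) powr p * m x)
        + C * ((\<Sum>\<^sub>\<infinity>x. norm (f x) powr p * m x) - (\<Sum>\<^sub>\<infinity>x. norm (avg R f x) powr p * m x))"
proof -
  obtain C where C1: "1 \<le> C" and C: "\<And>F w (b :: 'a \<Rightarrow> complex) a. finite F \<Longrightarrow>
       (\<And>y. y \<in> F \<Longrightarrow> 0 \<le> w y) \<Longrightarrow> (\<Sum>y\<in>F. w y) = 1 \<Longrightarrow> a = (\<Sum>y\<in>F. w y *\<^sub>R b y) \<Longrightarrow>
       (\<Sum>y\<in>F. w y * norm (b y - a) powr p)
       \<le> \<delta> * (norm a powr p + (\<Sum>y\<in>F. w y * norm (b y) powr p))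
         + C * ((\<Sum>y\<in>F. w y * norm (b y) powr p) - norm a powr p)"
    using averaged_convexity_defect[OF assms] by blast
  show ?thesis
  proof (rule that[OF C1])
    fix m R and f :: "'a \<Rightarrow> complex" and F :: "'a set"
    assume R: "rev_markov m R" and f: "f \<in> Lq m (ereal p)" and F: "finite F"
    interpret rev_markov m R by fact
    interpret lq_space m "ereal p" using lq_space p by simp
    define g where "g = avg R f"
    define u where "u x = norm (f x) powr p" for x
    define v where "v x = norm (g x) powr p" for x
    define D where "D x = (\<Sum>y | R x y \<noteq> 0. R x y * norm (f y - g x) powr p)" for x
    define E where "E x = \<delta> * (v x + avg R u x) + C * (avg R u x - v x)" for x
    have DE: "D x \<le> E x" for x
      using C[OF finite_row, where w = "R x" and a = "g x" and b = f] kernel_nonneg row_sum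
      unfolding D_def E_def v_def u_def g_def avg_def by simp
    have D0: "0 \<le> D x" for x unfolding D_def using kernel_nonneg by (intro sum_nonneg) auto
    have m0: "0 \<le> m x" for x using meas_pos[of x] by simp
    have gl: "lq_le m (ereal p) (Lq_norm m (ereal p) f) g"
      unfolding g_def by (intro lq_le_avg lq_le_Lq_norm f) (use p in auto)
    have su: "(\<lambda>x. u x * m x) summable_on UNIV" using f by (simp add: Lq_def u_def)
    have sv: "(\<lambda>x. v x * m x) summable_on UNIV" using lq_leD(1)[OF gl] by (simp add: Lq_def v_def)
    define Nu Nv where "Nu = (\<Sum>\<^sub>\<infinity>x. u x * m x)" and "Nv = (\<Sum>\<^sub>\<infinity>x. v x * m x)"
    have le1: "(\<Sum>x\<in>F. avg R u x * m x) \<le> Nu" if "finite F" for F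
    proof -
      have "(\<Sum>x\<in>F. m x * avg R u x) \<le> Nu"
        using that m0 unfolding Nu_def
        by (intro sum_avg_le) (auto simp: u_def mult.commute[of "m _"] intro!: finite_sum_le_infsum su[unfolded u_def])
      then show ?thesis by (simp add: mult.commute)
    qed
    have au0: "0 \<le> avg R u x" for x
      unfolding avg_def u_def using kernel_nonneg by (intro sum_nonneg) auto
    have sa: "(\<lambda>x. avg R u x * m x) summable_on UNIV"
      using m0 au0 le1 by (intro nonneg_bdd_above_summable_on bdd_aboveI2[where M = Nu]) auto
    define Na where "Na = (\<Sum>\<^sub>\<infinity>x. avg R u x * m x)"
    \<comment> \<open>Together with \<open>NvNa\<close> this gives
      \<open>Nv \<le> Na \<le> Nu\<close>, so the summed Jensen gap \<open>Na - Nv\<close> is at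
      most the energy loss \<open>Nu - Nv\<close>.\<close>
    have NaNu: "Na \<le> Nu" unfolding Na_def using le1 by (intro infsum_le_finite_sums sa) auto
    have NvNa: "Nv \<le> Na"
      unfolding Nv_def Na_def v_def g_def u_def
      using avg_jensen[of p f] m0 p sv[unfolded v_def g_def] sa[unfolded u_def]
      by (intro infsum_mono mult_right_mono) auto
    have Esum: "((\<lambda>x. E x * m x) has_sum (\<delta> * (Nv + Na) + C * (Na - Nv))) UNIV"
    proof -
      have "((\<lambda>x. (\<delta> - C) * (v x * m x) + (\<delta> + C) * (avg R u x * m x))
          has_sum ((\<delta> - C) * Nv + (\<delta> + C) * Na)) UNIV"
        unfolding Nv_def Na_def
        by (intro has_sum_add has_sum_cmult_right has_sum_infsum sv sa)
      moreover have "(\<lambda>x. (\<delta> - C) * (v x * m x) + (\<delta> + C) * (avg R u x * m x)) = (\<lambda>x. E x * m x)"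
        by (simp add: E_def fun_eq_iff algebra_simps)
      moreover have "(\<delta> - C) * Nv + (\<delta> + C) * Na = \<delta> * (Nv + Na) + C * (Na - Nv)"
        by (simp add: algebra_simps)
      ultimately show ?thesis by simp
    qed
    define G where "G = (\<Union>y\<in>F. {x. R y x \<noteq> 0})"
    have G: "finite G" using F finite_row by (auto simp: G_def)
    have "(\<Sum>y\<in>F. norm (f y - avg R g y) powr p * m y)
        \<le> (\<Sum>y\<in>F. \<Sum>x\<in>G. m y * R y x * norm (f y - g x) powr p)"
    proof (intro sum_mono)
      fix y assume y: "y \<in> F"
      have inG: "x \<in> G" if "R y x \<noteq> 0" for x using y that by (auto simp: G_def)
      have rowG: "(\<Sum>x\<in>G. R y x) = 1"
        using fun_cong[OF avg_one, of y] avg_eq_sum[where f = "\<lambda>_. 1::real", OF G inG] by simp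
      have "f y - avg R g y = (\<Sum>x\<in>G. R y x *\<^sub>R (f y - g x))"
        using avg_eq_sum[where f = g, OF G inG] rowG
        by (simp add: scaleR_diff_right sum_subtractf flip: scaleR_sum_left)
      then have "norm (f y - avg R g y) powr p \<le> (\<Sum>x\<in>G. R y x * norm (f y - g x) powr p)"
        using complex_jensen_powr[of p G "R y" "\<lambda>x. f y - g x"] p G kernel_nonneg rowG by simp
      then show "norm (f y - avg R g y) powr p * m y \<le> (\<Sum>x\<in>G. m y * R y x * norm (f y - g x) powr p)"
        using m0[of y] mult_left_mono[of _ _ "m y"]
        by (simp add: mult.commute[of _ "m y"] mult.assoc flip: sum_distrib_left)
    qed
    \<comment> \<open>Reversibility moves the weight from \<open>y\<close> to \<open>x\<close>; the
      inner sum becomes a part of the row average \<open>D x\<close>.\<close>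
    also have "\<dots> = (\<Sum>x\<in>G. (\<Sum>y\<in>F. R x y * norm (f y - g x) powr p) * m x)"
    proof -
      have *: "m y * R y x * norm (f y - g x) powr p = R x y * norm (f y - g x) powr p * m x" for x y
        using reversible[of y x] by simp
      show ?thesis by (subst sum.swap) (simp only: * sum_distrib_right)
    qed
    also have "\<dots> \<le> (\<Sum>x\<in>G. E x * m x)"
    proof (intro sum_mono mult_right_mono m0)
      fix x
      have "(\<Sum>y\<in>F. R x y * norm (f y - g x) powr p)
        = (\<Sum>y\<in>F \<inter> {y. R x y \<noteq> 0}. R x y * norm (f y - g x) powr p)"
        using F by (intro sum.mono_neutral_right) auto
      also have "\<dots> \<le> D x"
        unfolding D_def using finite_row kernel_nonneg by (intro sum_mono2) auto
      finally show "(\<Sum>y\<in>F. R x y * norm (f y - g x) powr p) \<le> E x" using DE by (rule order_trans)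
    qed
    also have "\<dots> \<le> \<delta> * (Nv + Na) + C * (Na - Nv)"
      using order_trans[OF D0 DE] m0
      by (intro finite_sum_le_has_sum[OF Esum G]) (auto intro!: mult_nonneg_nonneg)
    also have "\<dots> \<le> \<delta> * (Nu + Nu) + C * (Nu - Nv)"
      using \<delta> C1 NaNu NvNa by (intro add_mono mult_left_mono) auto
    finally show "(\<Sum>y\<in>F. norm (f y - avg R (avg R f) y) powr p * m y)
      \<le> 2 * \<delta> * (\<Sum>\<^sub>\<infinity>x. norm (f x) powr p * m x)
        + C * ((\<Sum>\<^sub>\<infinity>x. norm (f x) powr p * m x) - (\<Sum>\<^sub>\<infinity>x. norm (avg R f x) powr p * m x))"
      by (simp add: g_def u_def v_def Nu_def Nv_def algebra_simps)
  qed
qed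

text \<open>By contraction the \<open>p\<close>-th power sums of \<open>h M\<close> are at most
  those of \<open>h j\<close> for each \<open>j < M\<close>, and these are bounded by a small
  multiple of \<open>c powr p\<close> plus \<open>C\<close> times the energy lost in step
  \<open>j\<close>. Summed over \<open>j\<close> the losses telescope to at most
  \<open>c powr p\<close>, and dividing by \<open>M\<close> makes their share small.
  \<open>M\<close> depends on \<open>p\<close> and \<open>\<rho>\<close> alone.\<close>

lemma uniform_two_step_decay:
  fixes p \<rho> :: real
  assumes p: "1 < p" and \<rho>: "0 < \<rho>"
  obtains M where "1 \<le> M"
    "\<And>m R c (f :: 'a \<Rightarrow> complex). rev_markov m R \<Longrightarrow> lq_le m (ereal p) c f \<Longrightarrow>
      lq_le m (ereal p) (\<rho> * c) (\<lambda>x. (avg R ^^ M) f x - (avg R ^^ (M + 2)) f x)"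
proof -
  define \<delta> where "\<delta> = \<rho> powr p / 4"
  have \<rho>p: "0 < \<rho> powr p" using \<rho> by simp
  have \<delta>: "0 < \<delta>" using \<rho>p by (simp add: \<delta>_def)
  obtain C where C1: "1 \<le> C" and C: "\<And>m R (f :: 'a \<Rightarrow> complex) F. rev_markov m R \<Longrightarrow>
      f \<in> Lq m (ereal p) \<Longrightarrow> finite F \<Longrightarrow>
      (\<Sum>y\<in>F. norm (f y - avg R (avg R f) y) powr p * m y)
      \<le> 2 * \<delta> * (\<Sum>\<^sub>\<infinity>x. norm (f x) powr p * m x)
        + C * ((\<Sum>\<^sub>\<infinity>x. norm (f x) powr p * m x) - (\<Sum>\<^sub>\<infinity>x. norm (avg R f x) powr p * m x))"
    by (rule energy_inequality[OF p \<delta>]) (rule that)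
  \<comment> \<open>Chosen so that \<open>C / M\<close> is at most half of
    \<open>\<rho> powr p\<close>; the choice of \<open>\<delta>\<close> makes the other term exactly
    the remaining half.\<close>
  define M where "M = Suc (nat \<lceil>2 * C / \<rho> powr p\<rceil>)"
  have "2 * C / \<rho> powr p \<le> real M" unfolding M_def by linarith
  then have CM: "C \<le> real M * (\<rho> powr p / 2)" using \<rho>p by (simp add: field_simps)
  show ?thesis
  proof (rule that[of M])
    show "1 \<le> M" by (simp add: M_def)
    fix m R c and f :: "'a \<Rightarrow> complex"
    assume R: "rev_markov m R" and f: "lq_le m (ereal p) c f"
    interpret rev_markov m R by fact
    interpret lq_space m "ereal p" using lq_space p by simp
    define N where "N j = (\<Sum>\<^sub>\<infinity>x. norm ((avg R ^^ j) f x) powr p * m x)" for j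
    have q1: "1 \<le> ereal p" using p by simp
    have c0: "0 \<le> c" using f by (rule lq_le_nonneg)
    have fj: "lq_le m (ereal p) c ((avg R ^^ j) f)" for j using q1 f by (rule lq_le_funpow_avg)
    have fL: "(avg R ^^ j) f \<in> Lq m (ereal p)" for j using lq_leD(1)[OF fj] .
    have Nc: "N j \<le> c powr p" for j
      unfolding N_def using fj[of j] fL[of j]
      by (intro infsum_le_finite_sums) (auto simp: lq_le_ereal Lq_def)
    have N0: "0 \<le> N j" for j unfolding N_def using meas_pos by (intro infsum_nonneg) (auto simp: less_imp_le)
    define h where "h j x = (avg R ^^ j) f x - (avg R ^^ (j + 2)) f x" for j x
    have hM: "(\<Sum>x\<in>F. norm (h M x) powr p * m x) \<le> 2 * \<delta> * c powr p + C * (N j - N (Suc j))"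
      if "finite F" "j < M" for F j
    proof -
      define B where "B = 2 * \<delta> * N j + C * (N j - N (Suc j))"
      have hjB: "(\<Sum>x\<in>F. norm (h j x) powr p * m x) \<le> B" if "finite F" for F
        using C[OF R fL[of j] that] by (simp add: h_def B_def N_def)
      have B0: "0 \<le> B" using hjB[of "{}"] by simp
      then have "lq_le m (ereal p) (B powr (1 / p)) (h j)"
        using hjB p by (simp add: lq_le_ereal powr_powr)
      then have "lq_le m (ereal p) (B powr (1 / p)) ((avg R ^^ (M - j)) (h j))"
        by (rule lq_le_funpow_avg[OF q1])
      moreover have "(avg R ^^ (M - j)) (h j) = h M"
      proof -
        have "(avg R ^^ (M - j)) (h j) = (\<lambda>x. ((avg R ^^ (M - j)) ((avg R ^^ j) f)) x
            - ((avg R ^^ (M - j)) ((avg R ^^ (j + 2)) f)) x)"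
          unfolding h_def by (rule funpow_avg_diff)
        also have "\<dots> = h M"
          using that(2) unfolding h_def funpow_add_apply[symmetric] by simp
        finally show ?thesis .
      qed
      ultimately have "(\<Sum>x\<in>F. norm (h M x) powr p * m x) \<le> B"
        using that(1) p B0 by (simp add: lq_le_ereal powr_powr)
      also have "\<dots> \<le> 2 * \<delta> * c powr p + C * (N j - N (Suc j))"
        unfolding B_def using Nc \<delta> by (intro add_right_mono mult_left_mono) auto
      finally show ?thesis .
    qed
    have "(\<Sum>x\<in>F. norm (h M x) powr p * m x) \<le> (\<rho> * c) powr p" if "finite F" for F
    proof -
      define a where "a = (\<Sum>x\<in>F. norm (h M x) powr p * m x)"
      have "real M * a = (\<Sum>j<M. a)" by simp
      also have "\<dots> \<le> (\<Sum>j<M. 2 * \<delta> * c powr p + C * (N j - N (Suc j)))"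
        unfolding a_def using hM[OF that] by (intro sum_mono) auto
      also have "\<dots> = real M * (2 * \<delta> * c powr p) + C * (N 0 - N M)"
        using sum_lessThan_telescope'[of N M] by (simp add: sum.distrib flip: sum_distrib_left)
      also have "\<dots> \<le> real M * (2 * \<delta> * c powr p) + C * c powr p"
        using C1 Nc[of 0] N0[of M] by (intro add_left_mono mult_left_mono) auto
      also have "\<dots> \<le> real M * (2 * \<delta> * c powr p) + (real M * (\<rho> powr p / 2)) * c powr p"
        using CM by (intro add_left_mono mult_right_mono) auto
      also have "\<dots> = real M * (\<rho> powr p * c powr p)" by (simp add: \<delta>_def algebra_simps)
      finally have "a \<le> \<rho> powr p * c powr p" by (simp add: M_def)
      then show ?thesis using \<rho> c0 by (simp add: a_def powr_mult)
    qed
    then show "lq_le m (ereal p) (\<rho> * c) (\<lambda>x. (avg R ^^ M) f x - (avg R ^^ (M + 2)) f x)"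
      using \<rho> c0 by (simp add: lq_le_ereal h_def)
  qed
qed

text \<open>Write \<open>T\<close> for the operator, \<open>g = T^K f\<close> and
  \<open>h = g - T g\<close>. Then \<open>n h\<close> is \<open>g - T^n g\<close> plus the sum of
  \<open>h - T^j h\<close> over \<open>j < n\<close>. The first part is bounded by
  \<open>2 c\<close>. By \<open>small\<close>, each summand is bounded by a quarter of the inductive
  bound \<open>A\<close> at the smaller index \<open>L = K - n M\<close>.\<close>

lemma (in rev_markov) ritt_recursion:
  assumes q: "1 \<le> q" and M: "1 \<le> M"
    and small: "\<And>n c f. 1 \<le> n \<Longrightarrow> lq_le m q c f \<Longrightarrow>
      lq_le m q (c / 4) (\<lambda>x. (avg R ^^ (n * M)) f x - (avg R ^^ (n * M + n)) f x)"
    and f: "lq_le m q c f"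
  shows "lq_le m q (16 * real M / real (K + 1) * c) (\<lambda>x. (avg R ^^ K) f x - (avg R ^^ Suc K) f x)"
proof (induction K rule: less_induct)
  case (less K)
  interpret lq_space m q using lq_space q by simp
  let ?T = "avg R :: ('a \<Rightarrow> complex) \<Rightarrow> 'a \<Rightarrow> complex"
  have c0: "0 \<le> c" using f by (rule lq_le_nonneg)
  show ?case
  proof (cases "K < 2 * M")
    case True
    \<comment> \<open>For small \<open>K\<close> the trivial bound \<open>c + c\<close> already lies
      below the claim.\<close>
    then have "2 \<le> 16 * real M / real (K + 1)" by (simp add: field_simps)
    then have "c + c \<le> 16 * real M / real (K + 1) * c"
      using mult_right_mono[OF _ c0, of 2 "16 * real M / real (K + 1)"] by simp
    then show ?thesis by (rule lq_le_mono[OF lq_le_diff[OF lq_le_funpow_avg[OF q f] lq_le_funpow_avg[OF q f]]])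
  next
    case False
    \<comment> \<open>With this \<open>n\<close>, \<open>n * M\<close> is at most half of
      \<open>K\<close>, so passing from \<open>L\<close> to \<open>K\<close> costs a factor 2 at
      most, while \<open>n\<close> remains comparable to \<open>K / M\<close>.\<close>
    define n where "n = K div (2 * M)"
    have n1: "1 \<le> n" using False M by (simp add: n_def div_greater_zero_iff Suc_le_eq)
    have nM: "2 * M * n \<le> K" "K + 1 \<le> 2 * M * (n + 1)"
      using M dividend_less_times_div[of "2 * M" K] by (auto simp: n_def)
    define L where "L = K - n * M"
    define k where "k = n * M"
    have "2 * k \<le> K" "0 < k" using nM(1) n1 M by (auto simp: k_def mult_ac)
    then have "L < K" "K = k + L" "K + 1 \<le> 2 * (L + 1)" by (auto simp: L_def simp flip: k_def)
    then have LK: "L < K" "K = n * M + L" "K + 1 \<le> 2 * (L + 1)" by (simp_all only: k_def)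
    define A where "A = 16 * real M / real (L + 1) * c"
    define e where "e x = (?T ^^ L) f x - (?T ^^ Suc L) f x" for x
    have eA: "lq_le m q A e" unfolding A_def e_def using less.IH[OF LK(1)] .
    have A0: "0 \<le> A" using eA by (rule lq_le_nonneg)
    define g where "g = (?T ^^ K) f"
    define h where "h x = g x - ?T g x" for x
    have h_e: "(?T ^^ (n * M)) e = h"
      unfolding e_def funpow_avg_diff h_def g_def LK(2)
      by (simp add: fun_eq_iff funpow_add funpow_swap1)
    have step: "lq_le m q (A / 4) (\<lambda>x. h x - (?T ^^ j) h x)" if "j < n" for j
    proof (cases "j = 0")
      case True
      then show ?thesis using lq_le_mono[OF lq_le_zero, of "A / 4"] A0 by simp
    next
      case False
      \<comment> \<open>\<open>h\<close> is \<open>T^(n M) e\<close>. Holding back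
        \<open>j * M\<close> of these steps exhibits \<open>h\<close> as \<open>T^(j M) w\<close>,
        the form required by \<open>small\<close> with \<open>j\<close> in place of
        \<open>n\<close>.\<close>
      define w where "w = (?T ^^ ((n - j) * M)) e"
      have "lq_le m q A w" unfolding w_def by (intro lq_le_funpow_avg q eA)
      then have *: "lq_le m q (A / 4) (\<lambda>x. (?T ^^ (j * M)) w x - (?T ^^ (j * M + j)) w x)"
        using small[of j A w] False by simp
      have "j * M + (n - j) * M = n * M" using that by (simp flip: add_mult_distrib)
      then have wh: "(?T ^^ (j * M)) w = h"
        unfolding w_def h_e[symmetric] funpow_add_apply[symmetric] by simp
      then have "(?T ^^ (j * M + j)) w = (?T ^^ j) h"
        by (simp add: add.commute[of "j * M"] funpow_add_apply)
      then show ?thesis using * wh by simp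
    qed
    have gc: "lq_le m q c g" unfolding g_def by (rule lq_le_funpow_avg[OF q f])
    have "lq_le m q ((c + c) + (\<Sum>j<n. A / 4)) (\<lambda>x. (g x - (?T ^^ n) g x) + (\<Sum>j<n. h x - (?T ^^ j) h x))"
      by (rule lq_le_add[OF lq_le_diff[OF gc lq_le_funpow_avg[OF q gc]] lq_le_sum])
        (use step in auto)
    moreover have "(\<lambda>x. (g x - (?T ^^ n) g x) + (\<Sum>j<n. h x - (?T ^^ j) h x)) = (\<lambda>x. of_nat n * h x)"
    proof
      fix x
      have "(?T ^^ j) h x = (?T ^^ j) g x - (?T ^^ Suc j) g x" for j
        unfolding h_def funpow_avg_diff by (simp add: funpow_swap1)
      then have "(\<Sum>j<n. (?T ^^ j) h x) = g x - (?T ^^ n) g x"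
        using sum_lessThan_telescope'[of "\<lambda>j. (?T ^^ j) g x" n] by simp
      then show "(g x - (?T ^^ n) g x) + (\<Sum>j<n. h x - (?T ^^ j) h x) = of_nat n * h x"
        by (simp add: sum_subtractf)
    qed
    ultimately have "lq_le m q (2 * c + real n * A / 4) (\<lambda>x. of_nat n * h x)" by simp
    then have "lq_le m q (norm (1 / of_nat n :: complex) * (2 * c + real n * A / 4))
        (\<lambda>x. (1 / of_nat n) * (of_nat n * h x))"
      by (rule lq_le_cmult)
    then have "lq_le m q ((2 * c + real n * A / 4) / real n) h"
      using n1 by (simp add: norm_divide)
    moreover have "(2 * c + real n * A / 4) / real n \<le> 16 * real M / real (K + 1) * c"
    proof -
      have "M * 1 \<le> M * n" using n1 by (intro mult_le_mono) auto
      then have "2 * M * (n + 1) \<le> 4 * M * n" by (simp add: distrib_left del: One_nat_def mult_le_cancel1)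
      then have "K + 1 \<le> 4 * M * n" using nM(2) by (rule order_trans[rotated])
      then have "real (K + 1) \<le> real (4 * M * n)" by (simp only: of_nat_le_iff)
      then have "real (K + 1) \<le> 4 * real M * real n" by simp
      \<comment> \<open>Each of the two contributions is half of the claimed bound: this one by
        \<open>K + 1 \<le> 4 * M * n\<close>, the other by
        \<open>K + 1 \<le> 2 * (L + 1)\<close>.\<close>
      then have "2 / real n \<le> 8 * real M / real (K + 1)" using n1 by (simp add: field_simps)
      then have i1: "2 / real n * c \<le> 8 * real M / real (K + 1) * c" using c0 by (rule mult_right_mono)
      have "real (K + 1) \<le> real (2 * (L + 1))" using LK(3) by (simp only: of_nat_le_iff)
      then have "real (K + 1) \<le> 2 * real (L + 1)" by simp
      then have "1 / real (L + 1) \<le> 2 / real (K + 1)" by (simp add: field_simps)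
      then have "(16 * real M * c / 4) * (1 / real (L + 1)) \<le> (16 * real M * c / 4) * (2 / real (K + 1))"
        using c0 by (intro mult_left_mono) auto
      then have i2: "A / 4 \<le> 8 * real M / real (K + 1) * c" by (simp add: A_def field_simps)
      have "(2 * c + real n * A / 4) / real n = 2 / real n * c + A / 4"
        using n1 by (simp add: field_simps)
      also have "\<dots> \<le> 8 * real M / real (K + 1) * c + 8 * real M / real (K + 1) * c"
        using i1 i2 by (rule add_mono)
      also have "\<dots> = 16 * real M / real (K + 1) * c"
        by (simp flip: distrib_right add_divide_distrib)
      finally show ?thesis .
    qed
    ultimately have "lq_le m q (16 * real M / real (K + 1) * c) h" by (rule lq_le_mono)
    then show ?thesis by (simp add: h_def[abs_def] g_def)
  qed
qed

text \<open>The two-step decay is used for all powers \<open>kpow R n\<close> with one common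
  \<open>M\<close>; this uniformity in \<open>n\<close> is the premise \<open>small\<close> of
  \<open>ritt_recursion\<close> for the squared kernel.\<close>

lemma (in rev_markov) square_analytic:
  fixes p :: real
  assumes p: "1 < p"
  obtains A where "0 < A" "\<And>K c f. lq_le m (ereal p) c f \<Longrightarrow>
     lq_le m (ereal p) (A / real (K + 1) * c) (\<lambda>x. (avg R ^^ (2 * K)) f x - (avg R ^^ (2 * K + 2)) f x)"
proof -
  have quarter: "0 < (1/4 :: real)" by simp
  obtain M where M: "1 \<le> M" and small:
    "\<And>m R c (f :: 'a \<Rightarrow> complex). rev_markov m R \<Longrightarrow> lq_le m (ereal p) c f \<Longrightarrow>
      lq_le m (ereal p) (1/4 * c) (\<lambda>x. (avg R ^^ M) f x - (avg R ^^ (M + 2)) f x)"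
    by (rule uniform_two_step_decay[OF p quarter]) (rule that)
  have q: "1 \<le> ereal p" using p by simp
  let ?T = "avg R :: ('a \<Rightarrow> complex) \<Rightarrow> 'a \<Rightarrow> complex"
  let ?S = "avg (kpow R 2) :: ('a \<Rightarrow> complex) \<Rightarrow> 'a \<Rightarrow> complex"
  interpret S: rev_markov m "kpow R 2" by (rule rev_markov_kpow)
  have pw: "(avg (kpow R n) ^^ k) f = (?T ^^ (n * k)) f" for n k f
  proof -
    have "avg (kpow R n) = (?T ^^ n)" by (rule ext) (rule avg_kpow)
    then show ?thesis by (simp add: funpow_mult)
  qed
  have sm: "lq_le m (ereal p) (c / 4) (\<lambda>x. (?S ^^ (n * M)) f x - (?S ^^ (n * M + n)) f x)"
    if "lq_le m (ereal p) c f" for n c f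
  proof -
    have "lq_le m (ereal p) (1/4 * c) (\<lambda>x. (avg (kpow R n) ^^ M) f x - (avg (kpow R n) ^^ (M + 2)) f x)"
      by (rule small[OF rev_markov_kpow that])
    \<comment> \<open>The decay concerns \<open>T^(n M) - T^(n M + 2 n)\<close>. A further
      \<open>T^(n M)\<close> makes the exponents \<open>2 n M\<close> and
      \<open>2 n M + 2 n\<close>, which are powers of \<open>S = T^2\<close>.\<close>
    then have "lq_le m (ereal p) (1/4 * c)
        ((?T ^^ (n * M)) (\<lambda>x. (?T ^^ (n * M)) f x - (?T ^^ (n * (M + 2))) f x))"
      unfolding pw by (rule lq_le_funpow_avg[OF q])
    moreover have "(?T ^^ (n * M)) (\<lambda>x. (?T ^^ (n * M)) f x - (?T ^^ (n * (M + 2))) f x)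
        = (\<lambda>x. (?S ^^ (n * M)) f x - (?S ^^ (n * M + n)) f x)"
    proof -
      have "n * M + n * M = 2 * (n * M)" "n * M + n * (M + 2) = 2 * (n * M + n)" by (auto simp: algebra_simps)
      then show ?thesis
        unfolding funpow_avg_diff pw funpow_add_apply[symmetric] by (simp only:)
    qed
    ultimately show ?thesis by simp
  qed
  show ?thesis
  proof (rule that[of "16 * real M"])
    show "0 < 16 * real M" using M by simp
    fix K c f assume f: "lq_le m (ereal p) c f"
    have "lq_le m (ereal p) (16 * real M / real (K + 1) * c) (\<lambda>x. (?S ^^ K) f x - (?S ^^ Suc K) f x)"
      by (rule S.ritt_recursion[OF q M _ f]) (rule sm)
    then show "lq_le m (ereal p) (16 * real M / real (K + 1) * c)
        (\<lambda>x. (?T ^^ (2 * K)) f x - (?T ^^ (2 * K + 2)) f x)"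
      unfolding pw by simp
  qed
qed

section \<open>Estimates from below, spectrum and odd returns\<close>

context lq_space
begin

lemma lq_le_0D: "lq_le m q 0 f \<Longrightarrow> f x = 0"
  by (rule lq_le_pointwise[of x]) force

lemma Lq_norm_nonneg: "f \<in> Lq m q \<Longrightarrow> 0 \<le> Lq_norm m q f"
  using lq_le_nonneg[OF lq_le_Lq_norm] .

lemma Lq_norm_cmult_le: "f \<in> Lq m q \<Longrightarrow> Lq_norm m q (\<lambda>x. c * f x) \<le> norm c * Lq_norm m q f"
  by (rule lq_leD(2)[OF lq_le_cmult[OF lq_le_Lq_norm]])

lemma Lq_cmult: "f \<in> Lq m q \<Longrightarrow> (\<lambda>x. c * f x) \<in> Lq m q"
  by (rule lq_leD(1)[OF lq_le_cmult[OF lq_le_Lq_norm]])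

lemma Lq_add: "f \<in> Lq m q \<Longrightarrow> g \<in> Lq m q \<Longrightarrow> (\<lambda>x. f x + g x) \<in> Lq m q"
  by (rule lq_leD(1)[OF lq_le_add[OF lq_le_Lq_norm lq_le_Lq_norm]])

lemma Lq_diff: "f \<in> Lq m q \<Longrightarrow> g \<in> Lq m q \<Longrightarrow> (\<lambda>x. f x - g x) \<in> Lq m q"
  by (rule lq_leD(1)[OF lq_le_diff[OF lq_le_Lq_norm lq_le_Lq_norm]])

text \<open>\<open>Lq_opnorm\<close> tests functions of norm one; homogeneity extends the estimate
  to all others. Norm zero is separate because there is nothing to rescale.\<close>

lemma lq_le_of_unit:
  assumes unit: "\<And>f b. f \<in> Lq m q \<Longrightarrow> Lq_norm m q f = 1 \<Longrightarrow> lq_le m q b (A f) \<Longrightarrow> 1 \<le> G * b"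
    and lin: "\<And>c f. A (\<lambda>x. c * f x) = (\<lambda>x. c * A f x)"
    and G: "0 \<le> G" and f: "f \<in> Lq m q" and b: "lq_le m q b (A f)"
  shows "lq_le m q (G * b) f"
proof (cases "Lq_norm m q f = 0")
  case True
  then show ?thesis
    using lq_le_mono[OF lq_le_Lq_norm[OF f]] lq_le_nonneg[OF b] G by simp
next
  case False
  define a where "a = Lq_norm m q f"
  have a: "0 < a" using False Lq_norm_nonneg[OF f] by (simp add: a_def)
  define u where "u x = of_real (1 / a) * f x" for x
  have u: "u \<in> Lq m q" unfolding u_def[abs_def] using f by (rule Lq_cmult)
  have "Lq_norm m q u \<le> 1"
    using Lq_norm_cmult_le[OF f, of "of_real (1 / a)"] a by (simp add: u_def[abs_def] norm_divide flip: a_def)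
  moreover have "a \<le> a * Lq_norm m q u"
  proof -
    have "(\<lambda>x. of_real a * u x) = f" using a by (simp add: u_def fun_eq_iff)
    then show ?thesis using Lq_norm_cmult_le[OF u, of "of_real a"] a by (simp add: a_def)
  qed
  ultimately have u1: "Lq_norm m q u = 1" using a by simp
  have "lq_le m q (norm (of_real (1 / a) :: complex) * b) (A u)"
    unfolding u_def[abs_def] lin by (rule lq_le_cmult[OF b])
  then have "1 \<le> G * (norm (of_real (1 / a) :: complex) * b)" by (rule unit[OF u u1])
  then have "a \<le> G * b" using a by (simp add: norm_divide field_simps)
  then show ?thesis using lq_le_mono[OF lq_le_Lq_norm[OF f]] by (simp add: a_def)
qed

lemma Lq_opnorm_leI:
  assumes "\<And>f. lq_le m q 1 f \<Longrightarrow> lq_le m q K (A f)"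
  shows "Lq_opnorm m q A \<le> ereal K"
  unfolding Lq_opnorm_def
proof (rule SUP_least)
  fix f assume "f \<in> {f \<in> Lq m q. Lq_norm m q f = 1}"
  then have "lq_le m q K (A f)" using assms lq_le_Lq_norm[of f] by auto
  from lq_leD[OF this] show "(if A f \<in> Lq m q then ereal (Lq_norm m q (A f)) else \<infinity>) \<le> ereal K" by simp
qed

lemma Lq_opnorm_leD:
  assumes "Lq_opnorm m q A \<le> ereal K" "f \<in> Lq m q" "Lq_norm m q f = 1"
  shows "lq_le m q K (A f)"
proof -
  have "(if A f \<in> Lq m q then ereal (Lq_norm m q (A f)) else \<infinity>) \<le> ereal K"
    using assms unfolding Lq_opnorm_def SUP_le_iff by blast
  then show ?thesis using lq_le_mono[OF lq_le_Lq_norm] by (auto split: if_splits)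
qed

end

context rev_markov
begin

text \<open>The difference is the sum of \<open>(-R)^j (I + R) h\<close> over \<open>j < n\<close>,
  and each of these \<open>n\<close> terms has bound \<open>b\<close> by contraction.\<close>

lemma lq_le_alternating:
  assumes q: "1 \<le> q" and b: "lq_le m q b (\<lambda>x. h x + avg R h x)"
  shows "lq_le m q (real n * b) (\<lambda>x. h x - (- 1) ^ n * (avg R ^^ n) h x)"
proof (induction n)
  case 0
  then show ?case using lq_space.lq_le_zero[OF lq_space[OF q]] by simp
next
  case (Suc n)
  interpret lq_space m q using q by (rule lq_space)
  have "(avg R ^^ n) (\<lambda>x. h x + avg R h x) = (\<lambda>x. (avg R ^^ n) h x + (avg R ^^ Suc n) h x)"
    by (induction n) (simp_all add: avg_add)
  then have "lq_le m q b (\<lambda>x. (avg R ^^ n) h x + (avg R ^^ Suc n) h x)"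
    using lq_le_funpow_avg[OF q b, of n] by simp
  then have "lq_le m q (norm ((- 1) ^ n :: complex) * b)
      (\<lambda>x. (- 1) ^ n * ((avg R ^^ n) h x + (avg R ^^ Suc n) h x))"
    by (rule lq_le_cmult)
  from lq_le_add[OF Suc this] show ?case
    by (simp add: norm_power algebra_simps)
qed

text \<open>The estimate from below for \<open>I + R\<close>. Asking for \<open>h\<close> in
  \<open>Lq\<close> beforehand supplies a finite norm that can be absorbed in proofs of the
  estimate.\<close>

definition bounded_below :: "ereal \<Rightarrow> real \<Rightarrow> bool" where
  "bounded_below q G \<longleftrightarrow> 0 \<le> G \<and>
     (\<forall>h b. h \<in> Lq m q \<longrightarrow> lq_le m q b (\<lambda>x. h x + avg R h x) \<longrightarrow> lq_le m q (G * b) h)"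

text \<open>The geometric series of \<open>- c R\<close> is summed pointwise. The norm bound on the
  partial sums survives by \<open>lq_le_limit\<close>, and the equation passes to the limit because
  each value of \<open>avg R\<close> is a finite sum.\<close>

lemma neumann_solution:
  assumes q: "1 \<le> q" and c: "0 \<le> c" "c < 1" and f: "f \<in> Lq m q"
  obtains g where "g \<in> Lq m q" "\<And>x. g x + of_real c * avg R g x = f x"
proof -
  interpret lq_space m q using q by (rule lq_space)
  define a where "a = Lq_norm m q f"
  have fa: "lq_le m q a f" unfolding a_def by (rule lq_le_Lq_norm[OF f])
  have a0: "0 \<le> a" using fa by (rule lq_le_nonneg)
  define t where "t j x = (- of_real c) ^ j * (avg R ^^ j) f x" for j x
  have t: "lq_le m q (c ^ j * a) (t j)" for j
    using lq_le_cmult[OF lq_le_funpow_avg[OF q fa, of j], of "(- of_real c) ^ j"] c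
    by (simp add: t_def[abs_def] norm_power)
  have sc: "summable (\<lambda>j. c ^ j)" using c by (intro summable_geometric) simp
  have st: "summable (\<lambda>j. t j x)" for x
  proof -
    obtain K where K: "\<And>C f. lq_le m q C f \<Longrightarrow> norm (f x) \<le> K * C"
      by (rule lq_le_pointwise[of x]) (rule that)
    have "summable (\<lambda>j. K * (c ^ j * a))" using sc by (intro summable_mult summable_mult2)
    then show ?thesis by (rule summable_comparison_test') (use K[OF t] in simp)
  qed
  define s where "s n x = (\<Sum>j<n. t j x)" for n x
  define g where "g x = (\<Sum>j. t j x)" for x
  have s_lim: "(\<lambda>n. s n x) \<longlonglongrightarrow> g x" for x
    unfolding s_def g_def by (rule summable_LIMSEQ[OF st])
  have "lq_le m q (1 / (1 - c) * a) (s n)" for n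
  proof -
    have "(\<Sum>j<n. c ^ j) \<le> (\<Sum>j. c ^ j)" using c by (intro sum_le_suminf sc) auto
    also have "\<dots> = 1 / (1 - c)" using c by (intro suminf_geometric) simp
    finally have "(\<Sum>j<n. c ^ j * a) \<le> 1 / (1 - c) * a"
      unfolding sum_distrib_right[symmetric] using a0 by (rule mult_right_mono)
    moreover have "lq_le m q (\<Sum>j<n. c ^ j * a) (s n)"
      unfolding s_def[abs_def] using t by (intro lq_le_sum) auto
    ultimately show ?thesis using lq_le_mono by blast
  qed
  then have "g \<in> Lq m q" using s_lim by (intro lq_leD(1)[OF lq_le_limit]) auto
  moreover have "g x + of_real c * avg R g x = f x" for x
  proof -
    have "t (Suc j) x = - of_real c * avg R (t j) x" for j
      by (simp add: t_def[abs_def] avg_cmult)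
    then have step: "s (Suc n) x = f x - of_real c * avg R (s n) x" for n
      unfolding s_def sum.lessThan_Suc_shift
      by (simp add: t_def[of 0] avg_def scaleR_sum_right sum.swap[of _ "{..<n}"] sum_distrib_left sum_negf)
    have "(\<lambda>n. s (Suc n) x) \<longlonglongrightarrow> g x" using s_lim by (rule LIMSEQ_Suc)
    moreover have "(\<lambda>n. f x - of_real c * avg R (s n) x) \<longlonglongrightarrow> f x - of_real c * avg R g x"
      unfolding avg_def by (intro tendsto_intros s_lim)
    ultimately have "g x = f x - of_real c * avg R g x"
      unfolding step by (rule LIMSEQ_unique)
    then show ?thesis by simp
  qed
  ultimately show ?thesis by (rule that)
qed

section \<open>Invertibility of I + R from odd return probabilities\<close>

lemma split_odd_power:
  assumes "0 < e" "\<And>x. e \<le> kpow R n x x"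
  obtains e' Q where "0 < e'" "e' < 1" "rev_markov m Q"
    "\<And>f x. (avg R ^^ n) f x = of_real e' * f x + of_real (1 - e') * (avg Q f x :: complex)"
proof -
  interpret K: rev_markov m "kpow R n" by (rule rev_markov_kpow)
  \<comment> \<open>\<open>remove_diagonal\<close> requires a value strictly below 1.\<close>
  define e' where "e' = min e (1/2)"
  have e': "0 < e'" "e' < 1" "\<And>x. e' \<le> kpow R n x x"
    using assms(1) order_trans[OF min.cobounded1 assms(2)] by (auto simp: e'_def)
  show ?thesis
    using K.remove_diagonal[OF e'] that[OF e'(1,2)] unfolding avg_kpow by blast
qed

text \<open>For odd \<open>n\<close>, \<open>h + R^n h = (1 + e') h + (1 - e') Q h\<close>, and its
  norm is at most \<open>n b\<close> by \<open>lq_le_alternating\<close>. As \<open>Q\<close> is a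
  contraction, the norm \<open>a\<close> of \<open>h\<close> satisfies
  \<open>(1 + e') a \<le> n b + (1 - e') a\<close>, and the last term can be absorbed.\<close>

lemma odd_return_bounded_below:
  assumes q: "1 \<le> q" and n: "odd n" and e: "0 < e" "\<And>x. e \<le> kpow R n x x"
  obtains G where "bounded_below q G"
proof -
  interpret lq_space m q using q by (rule lq_space)
  obtain e' Q where e': "0 < e'" "e' < 1" and Q: "rev_markov m Q"
    and split: "\<And>f x. (avg R ^^ n) f x = of_real e' * f x + of_real (1 - e') * (avg Q f x :: complex)"
    by (rule split_odd_power[OF e]) (rule that)
  interpret Q: rev_markov m Q by (rule Q)
  have "lq_le m q (real n / (2 * e') * b) h"
    if h: "h \<in> Lq m q" and b: "lq_le m q b (\<lambda>x. h x + avg R h x)" for h b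
  proof -
    define a where "a = Lq_norm m q h"
    have ha: "lq_le m q a h" unfolding a_def by (rule lq_le_Lq_norm[OF h])
    have "lq_le m q (real n * b + norm (of_real (1 - e') :: complex) * a)
        (\<lambda>x. (h x - (- 1) ^ n * (avg R ^^ n) h x) - of_real (1 - e') * avg Q h x)"
      by (intro lq_le_diff lq_le_cmult lq_le_alternating[OF q b] Q.lq_le_avg[OF q ha])
    moreover have "(h x - (- 1) ^ n * (avg R ^^ n) h x) - of_real (1 - e') * avg Q h x
        = of_real (1 + e') * h x" for x
      using n by (simp add: split algebra_simps)
    moreover have "norm (of_real (1 - e') :: complex) = 1 - e'" using e' by (simp only: norm_of_real)
    ultimately have "lq_le m q (real n * b + (1 - e') * a) (\<lambda>x. of_real (1 + e') * h x)" by simp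
    from lq_le_cmult[OF this, of "of_real (1 / (1 + e'))"]
    have "lq_le m q (norm (of_real (1 / (1 + e')) :: complex) * (real n * b + (1 - e') * a)) h"
      using e' by (simp flip: of_real_add of_real_mult mult.assoc)
    moreover have "norm (of_real (1 / (1 + e')) :: complex) = 1 / (1 + e')"
      unfolding norm_of_real using e' by simp
    ultimately have "a \<le> 1 / (1 + e') * (real n * b + (1 - e') * a)"
      unfolding a_def using lq_leD(2) by metis
    then have "(1 + e') * a \<le> real n * b + (1 - e') * a" using e' by (simp add: field_simps)
    then have "2 * e' * a \<le> real n * b" by (simp add: algebra_simps)
    then have "a \<le> real n / (2 * e') * b" using e' by (simp add: field_simps)
    then show ?thesis by (rule lq_le_mono[OF ha])
  qed
  then show ?thesis using that[of "real n / (2 * e')"] e' by (simp add: bounded_below_def)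
qed

text \<open>First \<open>g0 + R^n g0 = f\<close> is solved: divided by \<open>1 + e'\<close> it is a
  Neumann equation for \<open>Q\<close> with ratio \<open>c < 1\<close>. For odd \<open>n\<close>,
  \<open>I + R^n\<close> is \<open>I + R\<close> times the alternating sum of \<open>R^j\<close>
  over \<open>j < n\<close>, and applying that sum to \<open>g0\<close> gives
  \<open>g\<close>.\<close>

lemma odd_return_surjective:
  assumes q: "1 \<le> q" and n: "odd n" and e: "0 < e" "\<And>x. e \<le> kpow R n x x" and f: "f \<in> Lq m q"
  obtains g where "g \<in> Lq m q" "\<And>x. g x + avg R g x = f x"
proof -
  interpret lq_space m q using q by (rule lq_space)
  obtain e' Q where e': "0 < e'" "e' < 1" and Q: "rev_markov m Q"
    and split: "\<And>f x. (avg R ^^ n) f x = of_real e' * f x + of_real (1 - e') * (avg Q f x :: complex)"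
    by (rule split_odd_power[OF e]) (rule that)
  interpret Q: rev_markov m Q by (rule Q)
  define c where "c = (1 - e') / (1 + e')"
  have c: "0 \<le> c" "c < 1" using e' by (auto simp: c_def field_simps)
  have "(\<lambda>x. of_real (1 / (1 + e')) * f x) \<in> Lq m q" using f by (rule Lq_cmult)
  then obtain g0 where g0: "g0 \<in> Lq m q"
    "\<And>x. g0 x + of_real c * avg Q g0 x = of_real (1 / (1 + e')) * f x"
    by (rule Q.neumann_solution[OF q c]) (rule that)
  have fx: "g0 x + (avg R ^^ n) g0 x = f x" for x
  proof -
    have "of_real (1 + e') * of_real (1 / (1 + e')) = (1 :: complex)"
      unfolding of_real_mult[symmetric] using e' by simp
    then have "f x = of_real (1 + e') * (of_real (1 / (1 + e')) * f x)" by (simp only: mult.assoc[symmetric] mult_1)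
    also have "\<dots> = of_real (1 + e') * g0 x + of_real (1 + e') * of_real c * avg Q g0 x"
      unfolding g0(2)[symmetric] by (simp add: distrib_left mult.assoc)
    also have "of_real (1 + e') * of_real c = (of_real (1 - e') :: complex)"
      unfolding of_real_mult[symmetric] c_def using e' by simp
    finally show ?thesis unfolding split by (simp add: algebra_simps)
  qed
  define g where "g x = (\<Sum>j<n. (- 1) ^ j * (avg R ^^ j) g0 x)" for x
  have "lq_le m q (Lq_norm m q g0) ((avg R ^^ j) g0)" for j
    by (rule lq_le_funpow_avg[OF q lq_le_Lq_norm[OF g0(1)]])
  then have "lq_le m q (\<Sum>j<n. norm ((- 1) ^ j :: complex) * Lq_norm m q g0) g"
    unfolding g_def[abs_def] by (intro lq_le_sum lq_le_cmult) auto
  then have "g \<in> Lq m q" by (rule lq_leD(1))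
  moreover have "g x + avg R g x = f x" for x
  proof -
    have "avg R g x = (\<Sum>j<n. (- 1) ^ j * (avg R ^^ Suc j) g0 x)"
      by (simp add: g_def[abs_def] avg_def scaleR_sum_right sum.swap[of _ "{..<n}"] sum_distrib_left)
    then have "g x + avg R g x
        = (\<Sum>j<n. (- 1) ^ j * (avg R ^^ j) g0 x - (- 1) ^ Suc j * (avg R ^^ Suc j) g0 x)"
      by (simp add: g_def sum.distrib)
    also have "\<dots> = g0 x - (- 1) ^ n * (avg R ^^ n) g0 x"
      using sum_lessThan_telescope'[of "\<lambda>j. (- 1) ^ j * (avg R ^^ j) g0 x" n] by simp
    also have "\<dots> = f x" using n fx[of x] by simp
    finally show ?thesis .
  qed
  ultimately show ?thesis by (rule that)
qed

text \<open>Surjectivity provides preimages; the estimate from below makes them unique, hence linear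
  in the data, and bounds them by \<open>G\<close>.\<close>

lemma minus_one_notin_spectrumI:
  assumes q: "1 \<le> q" and G: "bounded_below q G"
    and surj: "\<And>f. f \<in> Lq m q \<Longrightarrow> \<exists>g. g \<in> Lq m q \<and> (\<lambda>x. g x + avg R g x) = f"
  shows "- 1 \<notin> Lq_spectrum m q (avg R)"
proof -
  interpret lq_space m q using q by (rule lq_space)
  define A :: "('a \<Rightarrow> complex) \<Rightarrow> 'a \<Rightarrow> complex" where "A g = (\<lambda>x. - 1 * g x - avg R g x)" for g
  have A_add: "A (\<lambda>x. f x + g x) = (\<lambda>x. A f x + A g x)"
    and A_diff: "A (\<lambda>x. f x - g x) = (\<lambda>x. A f x - A g x)"
    and A_cmult: "A (\<lambda>x. c * f x) = (\<lambda>x. c * A f x)" for f g c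
    by (auto simp: A_def avg_add avg_diff avg_cmult algebra_simps)
  have A_minus: "A g x = - (g x + avg R g x)" for g x by (simp add: A_def)
  have below: "lq_le m q (G * b) h" if "h \<in> Lq m q" "lq_le m q b (A h)" for h b
  proof -
    have "lq_le m q b (\<lambda>x. h x + avg R h x)"
      by (rule lq_le_norm_le[OF that(2)]) (simp only: A_minus norm_minus_cancel order_refl)
    then show ?thesis using G that(1) by (auto simp: bounded_below_def)
  qed
  have inj: "f = g" if "f \<in> Lq m q" "g \<in> Lq m q" "A f = A g" for f g
  proof -
    have "lq_le m q 0 (A (\<lambda>x. f x - g x))" using that(3) lq_le_zero by (simp add: A_diff)
    from below[OF Lq_diff[OF that(1,2)] this] have "lq_le m q 0 (\<lambda>x. f x - g x)" by simp
    from lq_le_0D[OF this] show ?thesis by auto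
  qed
  have ALq: "A g \<in> Lq m q" if "g \<in> Lq m q" for g
    unfolding A_def
    using lq_leD(1)[OF lq_le_avg[OF q lq_le_Lq_norm[OF that]]]
    by (intro Lq_diff Lq_cmult that)
  \<comment> \<open>Preimages are selected by choice; the algebraic laws of \<open>S\<close> follow
    by comparing images under \<open>A\<close> and using \<open>inj\<close>.\<close>
  define S where "S f = (SOME g. g \<in> Lq m q \<and> A g = f)" for f
  have S: "S f \<in> Lq m q" "A (S f) = f" if f: "f \<in> Lq m q" for f
  proof -
    obtain g where g: "g \<in> Lq m q" "(\<lambda>x. g x + avg R g x) = (\<lambda>x. - 1 * f x)"
      using surj[OF Lq_cmult[OF f, of "- 1"]] by blast
    have "A g = f"
    proof
      fix x
      have "g x + avg R g x = - 1 * f x" using g(2) by (rule fun_cong)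
      then show "A g x = f x" unfolding A_minus by (simp only: mult_minus1 minus_minus)
    qed
    then have "\<exists>g. g \<in> Lq m q \<and> A g = f" using g(1) by blast
    then have "S f \<in> Lq m q \<and> A (S f) = f" unfolding S_def by (rule someI_ex)
    then show "S f \<in> Lq m q" "A (S f) = f" by auto
  qed
  have "Lq_bounded_op m q S"
    unfolding Lq_bounded_op_def
  proof (intro conjI ballI allI exI)
    fix f g assume fg: "f \<in> Lq m q" "g \<in> Lq m q"
    show "S f \<in> Lq m q" by (rule S(1)[OF fg(1)])
    show "S (\<lambda>x. f x + g x) = (\<lambda>x. S f x + S g x)"
      by (rule inj) (auto simp: S fg Lq_add A_add)
    show "S (\<lambda>x. c * f x) = (\<lambda>x. c * S f x)" for c
      by (rule inj) (auto simp: S fg Lq_cmult A_cmult)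
    show "Lq_norm m q (S f) \<le> G * Lq_norm m q f"
      using below[OF S(1), OF fg(1), of "Lq_norm m q f"] lq_le_Lq_norm[OF fg(1)] S(2)[OF fg(1)] lq_leD(2)
      by simp
  qed
  moreover have "S (A f) = f" if "f \<in> Lq m q" for f
    by (rule inj) (auto simp: S ALq that)
  ultimately show ?thesis
    using S(2) unfolding Lq_spectrum_def A_def by auto
qed

lemma bounded_below_of_spectrum:
  assumes q: "1 \<le> q" and sp: "- 1 \<notin> Lq_spectrum m q (avg R)"
  obtains G where "bounded_below q G"
proof -
  interpret lq_space m q using q by (rule lq_space)
  obtain S where S: "Lq_bounded_op m q S"
    "\<And>f. f \<in> Lq m q \<Longrightarrow> S (\<lambda>x. - 1 * f x - avg R f x) = f"
    using sp unfolding Lq_spectrum_def by blast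
  obtain C where C: "\<And>f. f \<in> Lq m q \<Longrightarrow> Lq_norm m q (S f) \<le> C * Lq_norm m q f"
    using S(1) unfolding Lq_bounded_op_def by blast
  \<comment> \<open>The sign of \<open>C\<close> is not known, whereas \<open>bounded_below\<close>
    asks for a nonnegative constant.\<close>
  have "lq_le m q (\<bar>C\<bar> * b) h"
    if h: "h \<in> Lq m q" and b: "lq_le m q b (\<lambda>x. h x + avg R h x)" for h b
  proof -
    define f where "f x = - 1 * h x - avg R h x" for x
    have "f = (\<lambda>x. - 1 * (h x + avg R h x))" by (simp add: f_def fun_eq_iff)
    then have fb: "lq_le m q b f" using lq_le_cmult[OF b, of "- 1"] by simp
    have "Lq_norm m q h \<le> C * Lq_norm m q f"
      using C[OF lq_leD(1)[OF fb]] S(2)[OF h] by (simp add: f_def[abs_def])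
    also have "\<dots> \<le> \<bar>C\<bar> * b"
      using lq_leD[OF fb] Lq_norm_nonneg by (intro mult_mono) auto
    finally show ?thesis by (rule lq_le_mono[OF lq_le_Lq_norm[OF h]])
  qed
  then show ?thesis using that[of "\<bar>C\<bar>"] by (simp add: bounded_below_def)
qed

section \<open>Analyticity and the estimate from below\<close>

lemma bounded_below_of_analytic:
  assumes q: "1 \<le> q"
    and an: "\<And>k. 1 \<le> k \<Longrightarrow>
      Lq_opnorm m q (\<lambda>f x. (avg R ^^ k) f x - avg R ((avg R ^^ k) f) x) \<le> ereal (C / real k)"
  obtains G where "bounded_below q G"
proof -
  interpret lq_space m q using q by (rule lq_space)
  \<comment> \<open>Even and at least \<open>C\<close>: the analytic term then has norm at most 1
    against a total of 2 for \<open>2 h\<close>.\<close>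
  define k where "k = 2 * Suc (nat \<lceil>\<bar>C\<bar>\<rceil>)"
  have k1: "1 \<le> k" "even k" by (auto simp: k_def)
  have "C \<le> real (nat \<lceil>\<bar>C\<bar>\<rceil>)" by linarith
  also have "\<dots> \<le> real k" by (simp add: k_def)
  finally have "C \<le> real k" .
  then have Ck: "C / real k \<le> 1" using k1(1) by (simp add: field_simps)
  have "1 \<le> real (2 * k + 1) * b"
    if h: "h \<in> Lq m q" "Lq_norm m q h = 1" and b: "lq_le m q b (\<lambda>x. h x + avg R h x)" for h b
  proof -
    have "lq_le m q 1 (\<lambda>x. (avg R ^^ k) h x - avg R ((avg R ^^ k) h) x)"
      using lq_le_mono[OF Lq_opnorm_leD[OF an[OF k1(1)] h] Ck] .
    \<comment> \<open>The parities of \<open>k\<close> and \<open>Suc k\<close> give the three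
      functions the signs with which they add up to \<open>2 * h x\<close>.\<close>
    from lq_le_add[OF this lq_le_add[OF lq_le_alternating[OF q b, of k] lq_le_alternating[OF q b, of "Suc k"]]]
    have "lq_le m q (1 + (real k * b + real (Suc k) * b)) (\<lambda>x. 2 * h x)"
      using k1(2) by simp
    from lq_le_cmult[OF this, of "1/2"]
    have "lq_le m q ((1 + (real k * b + real (Suc k) * b)) / 2) h" by (simp add: norm_divide)
    from lq_leD(2)[OF this] show ?thesis using h(2) by (simp add: algebra_simps)
  qed
  then have "lq_le m q (real (2 * k + 1) * b) h"
    if "h \<in> Lq m q" "lq_le m q b (\<lambda>x. h x + avg R h x)" for h b
    by (rule lq_le_of_unit[where A = "\<lambda>h x. h x + avg R h x"])
      (use that in \<open>auto simp: avg_cmult distrib_left\<close>)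
  then show ?thesis using that[of "real (2 * k + 1)"] by (auto simp: bounded_below_def)
qed

text \<open>The function \<open>h = (I - P) P^k f\<close> satisfies
  \<open>(I + P) h = (I - P^2) P^k f\<close>. Writing \<open>k = 2 K + r\<close>, the right-hand
  side is controlled by \<open>square_analytic\<close>, and the estimate from below transfers the
  decay to \<open>h\<close>.\<close>

lemma analytic_of_bounded_below:
  fixes p :: real
  assumes p: "1 < p" and G: "bounded_below (ereal p) G"
  obtains C where "0 < C" "\<And>k. 1 \<le> k \<Longrightarrow>
    Lq_opnorm m (ereal p) (\<lambda>f x. (avg R ^^ k) f x - avg R ((avg R ^^ k) f) x) \<le> ereal (C / real k)"
proof -
  have q: "1 \<le> ereal p" using p by simp
  interpret lq_space m "ereal p" using q by (rule lq_space)
  obtain A where A: "0 < A" and sq: "\<And>K c f. lq_le m (ereal p) c f \<Longrightarrow>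
     lq_le m (ereal p) (A / real (K + 1) * c) (\<lambda>x. (avg R ^^ (2 * K)) f x - (avg R ^^ (2 * K + 2)) f x)"
    by (rule square_analytic[OF p]) (rule that)
  have G0: "0 \<le> G" using G by (simp add: bounded_below_def)
  \<comment> \<open>\<open>G\<close> may be 0; \<open>G + 1\<close> keeps the constant positive. The
    factor 2 pays for replacing \<open>K + 1\<close> by \<open>k\<close>.\<close>
  define C where "C = (G + 1) * (2 * A)"
  have "Lq_opnorm m (ereal p) (\<lambda>f x. (avg R ^^ k) f x - avg R ((avg R ^^ k) f) x) \<le> ereal (C / real k)"
    if k: "1 \<le> k" for k
  proof (rule Lq_opnorm_leI)
    fix f assume f: "lq_le m (ereal p) 1 f"
    define K r where "K = k div 2" and "r = k mod 2"
    have kr: "r + 2 * K = k" "r + (2 * K + 2) = k + 2" by (auto simp: K_def r_def)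
    define h where "h x = (avg R ^^ k) f x - avg R ((avg R ^^ k) f) x" for x
    have "lq_le m (ereal p) (A / real (K + 1) * 1)
        ((avg R ^^ r) (\<lambda>x. (avg R ^^ (2 * K)) f x - (avg R ^^ (2 * K + 2)) f x))"
      by (rule lq_le_funpow_avg[OF q sq[OF f]])
    moreover have "(avg R ^^ r) (\<lambda>x. (avg R ^^ (2 * K)) f x - (avg R ^^ (2 * K + 2)) f x)
        = (\<lambda>x. h x + avg R h x)"
      unfolding funpow_avg_diff funpow_add_apply[symmetric] kr by (simp add: h_def[abs_def] avg_diff)
    ultimately have "lq_le m (ereal p) (A / real (K + 1)) (\<lambda>x. h x + avg R h x)" by simp
    moreover have "h \<in> Lq m (ereal p)"
      unfolding h_def[abs_def]
      by (rule lq_leD(1)[OF lq_le_diff[OF lq_le_funpow_avg[OF q f] lq_le_avg[OF q lq_le_funpow_avg[OF q f]]]])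
    ultimately have "lq_le m (ereal p) (G * (A / real (K + 1))) h"
      using G unfolding bounded_below_def by blast
    moreover have "G * (A / real (K + 1)) \<le> C / real k"
    proof -
      have "real k \<le> real (2 * (K + 1))" unfolding of_nat_le_iff using kr(1) by (auto simp: K_def r_def)
      then have "A * real k \<le> A * real (2 * (K + 1))" using A by (intro mult_left_mono) auto
      then have "A / real (K + 1) \<le> 2 * A / real k" using k by (simp add: field_simps)
      then have "G * (A / real (K + 1)) \<le> (G + 1) * (2 * A / real k)"
        using G0 A by (intro mult_mono) auto
      then show ?thesis by (simp add: C_def)
    qed
    ultimately show "lq_le m (ereal p) (C / real k) (\<lambda>x. (avg R ^^ k) f x - avg R ((avg R ^^ k) f) x)"
      unfolding h_def[abs_def] by (rule lq_le_mono)
  qed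
  moreover have "0 < C" using A G0 by (simp add: C_def)
  ultimately show ?thesis using that by blast
qed

end

section \<open>The random walk on a weighted graph\<close>

definition step_prob :: "('a \<Rightarrow> 'a \<Rightarrow> real) \<Rightarrow> 'a \<Rightarrow> 'a \<Rightarrow> real" where
  "step_prob \<mu> x y = \<mu> x y / vmeas \<mu> x"

lemma infsum_finite_support:
  assumes "finite S" "\<And>x. x \<notin> S \<Longrightarrow> f x = 0"
  shows "infsum f UNIV = sum f S"
proof -
  have "infsum f UNIV = infsum f S" using assms(2) by (intro infsum_cong_neutral) auto
  then show ?thesis using assms(1) by simp
qed

context weighted_graph
begin

lemma adj_sym: "adj \<mu> x y \<longleftrightarrow> adj \<mu> y x"
  by (simp add: adj_def weight_sym[of x y])

lemma weight_zero_iff: "\<mu> x y = 0 \<longleftrightarrow> \<not> adj \<mu> x y"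
  using weight_nonneg[of x y] by (auto simp: adj_def)

lemma degree_bound:
  obtains N where "\<And>x. card {y. adj \<mu> x y} \<le> N"
proof -
  obtain N where N: "\<And>x. finite ({y. adj \<mu> y x} \<union> {x}) \<and> card ({y. adj \<mu> y x} \<union> {x}) \<le> N"
    using locally_uniformly_finite by blast
  have "card {y. adj \<mu> x y} \<le> N" for x
  proof -
    have "card {y. adj \<mu> x y} \<le> card ({y. adj \<mu> y x} \<union> {x})"
      using N[of x] by (intro card_mono) (auto simp: adj_sym[of x])
    then show ?thesis using N[of x] by (meson order_trans)
  qed
  then show ?thesis by (rule that)
qed

lemma finite_adj: "finite {y. adj \<mu> x y}"
  using locally_uniformly_finite adj_sym[of x] by (auto intro: finite_subset)

text \<open>There is a second vertex, and a path from \<open>x\<close> to it starts with an edge of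
  positive weight.\<close>

lemma vmeas_pos: "0 < vmeas \<mu> x"
proof -
  obtain y where "y \<noteq> x"
    using infinite_vertices by (metis (full_types) UNIV_I finite.simps finite_subset insertI1 subsetI singletonI)
  obtain n where n: "(adj \<mu> ^^ n) x y" using path_dist_finiteD[OF connected] by blast
  with \<open>y \<noteq> x\<close> obtain k where "n = Suc k" by (cases n) auto
  then have "(adj \<mu> ^^ Suc k) x y" using n by simp
  then obtain z where "adj \<mu> x z" by (rule relpowp_Suc_E2)
  then show ?thesis
    unfolding vmeas_def by (intro sum_pos[OF finite_adj]) (auto simp: adj_def)
qed

lemma step_prob_nonzero: "step_prob \<mu> x y \<noteq> 0 \<longleftrightarrow> adj \<mu> x y"
  using vmeas_pos[of x] by (simp add: step_prob_def weight_zero_iff)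

sublocale walk: rev_markov "vmeas \<mu>" "step_prob \<mu>"
proof
  fix x y
  show "0 \<le> step_prob \<mu> x y" using vmeas_pos[of x] weight_nonneg by (simp add: step_prob_def)
  show "finite {y. step_prob \<mu> x y \<noteq> 0}" by (simp add: step_prob_nonzero finite_adj)
  show "vmeas \<mu> x * step_prob \<mu> x y = vmeas \<mu> y * step_prob \<mu> y x"
    using vmeas_pos[of x] vmeas_pos[of y] weight_sym[of x y] by (simp add: step_prob_def)
  have "(\<Sum>y | adj \<mu> x y. step_prob \<mu> x y) = 1"
    using vmeas_pos[of x] by (simp add: step_prob_def vmeas_def flip: sum_divide_distrib)
  then show "(\<Sum>y | step_prob \<mu> x y \<noteq> 0. step_prob \<mu> x y) = 1" by (simp add: step_prob_nonzero)
qed (rule vmeas_pos)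

lemma avg_step_prob: "avg (step_prob \<mu>) f x = (\<Sum>y | adj \<mu> x y. step_prob \<mu> x y *\<^sub>R f y)"
  by (simp add: avg_def step_prob_nonzero)

lemma kern_mult_vmeas: "kern \<mu> x y * vmeas \<mu> y = step_prob \<mu> x y"
  using vmeas_pos[of y] by (simp add: kern_def step_prob_def)

lemma kern_eq_0: "\<not> adj \<mu> x y \<Longrightarrow> kern \<mu> x y = 0"
  using weight_zero_iff by (simp add: kern_def)

lemma markov_eq_avg: "markov \<mu> = avg (step_prob \<mu>)"
proof (intro ext)
  fix f x
  have "markov \<mu> f x = (\<Sum>y | adj \<mu> x y. of_real (kern \<mu> x y) * f y * of_real (vmeas \<mu> y))"
    unfolding markov_def by (intro infsum_finite_support finite_adj) (simp add: kern_eq_0)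
  also have "\<dots> = avg (step_prob \<mu>) f x"
    unfolding avg_step_prob kern_mult_vmeas[symmetric]
    by (intro sum.cong refl) (simp add: scaleR_conv_of_real)
  finally show "markov \<mu> f x = avg (step_prob \<mu>) f x" .
qed

text \<open>Turns condition (v) into a lower bound on odd return probabilities of
  \<open>step_prob\<close>.\<close>

lemma kern_iter_mult_vmeas: "kern_iter \<mu> k x y * vmeas \<mu> y = kpow (step_prob \<mu>) k x y"
proof (induction k arbitrary: x)
  case 0
  then show ?case using vmeas_pos[of y] by (simp add: walk.kpow_0)
next
  case (Suc k)
  have "kern_iter \<mu> (Suc k) x y = (\<Sum>z | adj \<mu> x z. kern \<mu> x z * kern_iter \<mu> k z y * vmeas \<mu> z)"
    unfolding kern_iter.simps by (intro infsum_finite_support finite_adj) (simp add: kern_eq_0)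
  also have "\<dots> = (\<Sum>z | adj \<mu> x z. step_prob \<mu> x z * kern_iter \<mu> k z y)"
    by (simp add: mult_ac flip: kern_mult_vmeas)
  finally show ?case
    by (simp add: walk.kpow_Suc avg_step_prob sum_distrib_right mult.assoc flip: Suc)
qed

section \<open>The \<epsilon>-graph: bipartite balls and odd returns\<close>

lemma kern_nonneg: "0 \<le> kern \<mu> x y"
  using weight_nonneg vmeas_pos[of x] vmeas_pos[of y] by (simp add: kern_def)

lemma symp_eps_adj: "symp (eps_adj \<mu> \<epsilon>)"
  by (rule sympI) (simp add: eps_adj_def kern_def weight_sym mult.commute min.commute)

lemma eps_adj_imp_adj: "0 < \<epsilon> \<Longrightarrow> eps_adj \<mu> \<epsilon> x y \<Longrightarrow> adj \<mu> x y"
  using kern_eq_0[of x y] by (cases "adj \<mu> x y") (auto simp: eps_adj_def)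

text \<open>The ball of radius \<open>r0 + 1\<close> is never bipartite, so every vertex has a
  closed \<epsilon>-path of length \<open>2 * r0 + 1\<close>. Each \<epsilon>-edge has step
  probability at least \<open>\<epsilon>\<close>, because the minimum in \<open>eps_adj\<close> is
  at most the measure of the target.\<close>

lemma odd_return_of_bipartite_bound:
  assumes e: "0 < \<epsilon>"
    and r0: "\<And>x r. 1 \<le> r \<Longrightarrow> eps_bipartite \<mu> \<epsilon> (eps_ball \<mu> \<epsilon> x r) \<Longrightarrow> r \<le> r0"
  shows "\<epsilon> ^ (2 * r0 + 1) \<le> kpow (step_prob \<mu>) (2 * r0 + 1) x x"
proof (rule walk.kpow_ge)
  show "(eps_adj \<mu> \<epsilon> ^^ (2 * r0 + 1)) x x"
  proof (rule odd_closed_path[OF symp_eps_adj])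
    show "\<not> eps_bipartite \<mu> \<epsilon> (eps_ball \<mu> \<epsilon> x (Suc r0))" using r0[of "Suc r0" x] by auto
  qed
  fix y z assume "eps_adj \<mu> \<epsilon> y z"
  then have "\<epsilon> \<le> kern \<mu> y z * min (vmeas \<mu> y) (vmeas \<mu> z)" by (simp add: eps_adj_def)
  also have "\<dots> \<le> kern \<mu> y z * vmeas \<mu> z" by (intro mult_left_mono kern_nonneg) simp
  finally show "\<epsilon> \<le> step_prob \<mu> y z" by (simp add: kern_mult_vmeas)
qed (use e in simp)

text \<open>The weight is \<open>kern\<close> times the product of the two measures, and this
  product is minimum times maximum.\<close>

lemma weight_le_of_not_eps_adj:
  assumes "\<not> eps_adj \<mu> \<epsilon> x y"
  shows "\<mu> x y \<le> \<epsilon> * max (vmeas \<mu> x) (vmeas \<mu> y)"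
proof -
  have "max (vmeas \<mu> x) (vmeas \<mu> y) * min (vmeas \<mu> x) (vmeas \<mu> y) = vmeas \<mu> x * vmeas \<mu> y"
    by (simp add: max_def min_def)
  then have "\<mu> x y = kern \<mu> x y * min (vmeas \<mu> x) (vmeas \<mu> y) * max (vmeas \<mu> x) (vmeas \<mu> y)"
    using vmeas_pos[of x] vmeas_pos[of y] by (simp add: kern_def mult_ac)
  also have "\<dots> \<le> \<epsilon> * max (vmeas \<mu> x) (vmeas \<mu> y)"
    using assms vmeas_pos[of x] by (intro mult_right_mono) (auto simp: eps_adj_def less_imp_le max_def)
  finally show ?thesis .
qed

text \<open>Balls are defined by a strict inequality, so a neighbour lies in the ball of radius 2,
  whose volume is controlled by the measure of its centre.\<close>

lemma neighbour_vmeas_bound: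
  assumes "polynomial_volume \<mu>"
  obtains C where "1 \<le> C" "\<And>x y. adj \<mu> x y \<Longrightarrow> vmeas \<mu> y \<le> C * vmeas \<mu> x"
proof -
  obtain C D where "0 < C" and vol: "\<And>x r. 1 \<le> r \<Longrightarrow> volume \<mu> x r \<le> C * real r powr D * vmeas \<mu> x"
    using assms unfolding polynomial_volume_def by blast
  have "vmeas \<mu> y \<le> max 1 (C * 2 powr D) * vmeas \<mu> x" if "adj \<mu> x y" for x y
  proof -
    have "y \<in> path_ball (adj \<mu>) x 2"
      using path_ball_step[where r = 1, OF center_in_path_ball[of 1 x "adj \<mu>"] that] by (simp add: numeral_2_eq_2)
    then have "vmeas \<mu> y \<le> volume \<mu> x 2"
      unfolding volume_def using vmeas_pos
      by (intro member_le_sum finite_path_ball finite_adj) (auto simp: less_imp_le)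
    also have "\<dots> \<le> C * 2 powr D * vmeas \<mu> x" using vol[of 2 x] by simp
    also have "\<dots> \<le> max 1 (C * 2 powr D) * vmeas \<mu> x"
      using vmeas_pos[of x] by (intro mult_right_mono) auto
    finally show ?thesis .
  qed
  then show ?thesis using that[of "max 1 (C * 2 powr D)"] by simp
qed

lemma finite_eps_ball: "0 < \<epsilon> \<Longrightarrow> finite (eps_ball \<mu> \<epsilon> x r)"
  by (rule finite_subset[OF path_ball_mono_rel finite_path_ball[OF finite_adj]]) (rule eps_adj_imp_adj)

text \<open>If every annulus below radius \<open>r\<close> exceeded the share
  \<open>\<delta>\<close>, the measure of the balls would grow like
  \<open>(1 + \<delta>) ^ r\<close>, against polynomial growth. Since \<epsilon>-balls lie inside
  graph balls, \<open>r0\<close> is uniform in \<open>\<epsilon>\<close> and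
  \<open>x\<close>.\<close>

lemma thin_annulus:
  assumes "polynomial_volume \<mu>" "0 < \<delta>"
  obtains r0 where "1 \<le> r0"
    "\<And>\<epsilon> x (r::nat). 0 < \<epsilon> \<Longrightarrow> r0 < r \<Longrightarrow> \<exists>s\<ge>1. s < r \<and>
       (\<Sum>y\<in>eps_ball \<mu> \<epsilon> x (Suc s) - eps_ball \<mu> \<epsilon> x s. vmeas \<mu> y) \<le> \<delta> * (\<Sum>y\<in>eps_ball \<mu> \<epsilon> x s. vmeas \<mu> y)"
proof -
  obtain C D where C: "0 < C" and D: "0 < D"
    and vol: "\<And>x r. 1 \<le> r \<Longrightarrow> volume \<mu> x r \<le> C * real r powr D * vmeas \<mu> x"
    using assms(1) unfolding polynomial_volume_def by blast
  \<comment> \<open>The extra factor \<open>1 + \<delta>\<close> on the left accounts for growth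
    starting at radius 1, which leaves the exponent \<open>r - 1\<close>.\<close>
  have "eventually (\<lambda>r::nat. (1 + \<delta>) * (C * real r powr D) < (1 + \<delta>) ^ r) at_top"
    using C D assms(2) by real_asymp
  then obtain r1 where r1: "\<And>r. r1 \<le> r \<Longrightarrow> (1 + \<delta>) * (C * real r powr D) < (1 + \<delta>) ^ r"
    unfolding eventually_sequentially by blast
  show ?thesis
  proof (rule that[of "Suc r1"])
    fix \<epsilon> x r assume e: "0 < (\<epsilon>::real)" and r: "Suc r1 < r"
    define B where "B = eps_ball \<mu> \<epsilon> x"
    define W where "W s = (\<Sum>y\<in>B s. vmeas \<mu> y)" for s
    have fin: "finite (B s)" for s unfolding B_def by (rule finite_eps_ball[OF e])
    have W_Suc: "W (Suc s) = W s + (\<Sum>y\<in>B (Suc s) - B s. vmeas \<mu> y)" for s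
    proof -
      have "B s \<subseteq> B (Suc s)" unfolding B_def by (rule path_ball_mono) simp
      then show ?thesis unfolding W_def using sum.subset_diff[OF _ fin] by (simp add: add.commute)
    qed
    show "\<exists>s\<ge>1. s < r \<and> (\<Sum>y\<in>eps_ball \<mu> \<epsilon> x (Suc s) - eps_ball \<mu> \<epsilon> x s. vmeas \<mu> y)
        \<le> \<delta> * (\<Sum>y\<in>eps_ball \<mu> \<epsilon> x s. vmeas \<mu> y)"
    proof (rule ccontr)
      assume "\<not> ?thesis"
      then have grow: "\<delta> * W s < (\<Sum>y\<in>B (Suc s) - B s. vmeas \<mu> y)" if "1 \<le> s" "s < r" for s
        using that by (force simp: W_def B_def)
      have "(1 + \<delta>) ^ n * vmeas \<mu> x \<le> W (Suc n)" if "Suc n \<le> r" for n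
        using that
      proof (induction n)
        case 0
        then show ?case by (simp add: W_def B_def path_ball_1)
      next
        case (Suc n)
        have "(1 + \<delta>) * ((1 + \<delta>) ^ n * vmeas \<mu> x) \<le> (1 + \<delta>) * W (Suc n)"
          using Suc assms(2) by (intro mult_left_mono) auto
        also have "\<dots> \<le> W (Suc (Suc n))"
          using grow[of "Suc n"] Suc.prems by (simp add: W_Suc[of "Suc n"] algebra_simps)
        finally show ?case by (simp add: mult.assoc)
      qed
      from this[of "r - 1"] have "(1 + \<delta>) ^ (r - 1) * vmeas \<mu> x \<le> W r" using r by simp
      also have "\<dots> \<le> volume \<mu> x r"
        unfolding W_def B_def volume_def using vmeas_pos eps_adj_imp_adj[OF e]
        by (intro sum_mono2 finite_path_ball finite_adj path_ball_mono_rel) (auto simp: less_imp_le)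
      also have "\<dots> \<le> C * real r powr D * vmeas \<mu> x" using r by (intro vol) simp
      finally have "(1 + \<delta>) ^ (r - 1) \<le> C * real r powr D" using vmeas_pos[of x] by simp
      then have "(1 + \<delta>) * (1 + \<delta>) ^ (r - 1) \<le> (1 + \<delta>) * (C * real r powr D)"
        using assms(2) by (intro mult_left_mono) auto
      moreover have "(1 + \<delta>) * (1 + \<delta>) ^ (r - 1) = (1 + \<delta>) ^ r"
        using r by (cases r) auto
      ultimately show False using r1[of r] r by simp
    qed
  qed simp
qed

text \<open>The test function is the indicator of the ball \<open>B\<close> multiplied by alternating signs. Edges of
  the \<open>\<epsilon>\<close>-graph inside \<open>B\<close> cancel in \<open>f + P f\<close>; those leaving \<open>B\<close> end in the annulus \<open>A\<close>, and all
  other edges have weight at most \<open>\<epsilon> C\<close> times the measure of either endpoint.\<close>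

lemma alternating_function_bound:
  assumes p: "1 \<le> p" and e: "0 < \<epsilon>"
    and N: "\<And>x. card {y. adj \<mu> x y} \<le> N"
    and C: "1 \<le> C" "\<And>x y. adj \<mu> x y \<Longrightarrow> vmeas \<mu> y \<le> C * vmeas \<mu> x"
    and bip: "eps_bipartite \<mu> \<epsilon> (eps_ball \<mu> \<epsilon> x r)" and s: "s < r"
    and G: "walk.bounded_below (ereal p) G"
  defines "B \<equiv> eps_ball \<mu> \<epsilon> x s" and "A \<equiv> eps_ball \<mu> \<epsilon> x (Suc s) - eps_ball \<mu> \<epsilon> x s"
  shows "(\<Sum>y\<in>B. vmeas \<mu> y) \<le> G powr p * 2 powr p *
    (2 * (\<Sum>y\<in>A. vmeas \<mu> y) + 4 * \<epsilon> * C * real N * (\<Sum>y\<in>B. vmeas \<mu> y))"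
proof -
  have q: "1 \<le> ereal p" using p by simp
  interpret lq_space "vmeas \<mu>" "ereal p" using q by (rule walk.lq_space)
  have m0: "0 \<le> vmeas \<mu> y" for y using vmeas_pos[of y] by simp
  have finB: "finite B" and finA: "finite A" using finite_eps_ball[OF e] by (auto simp: A_def B_def)
  define MA MB where "MA = (\<Sum>y\<in>A. vmeas \<mu> y)" and "MB = (\<Sum>y\<in>B. vmeas \<mu> y)"
  have MB0: "0 \<le> MB" and MA0: "0 \<le> MA" unfolding MA_def MB_def by (auto intro!: sum_nonneg m0)
  define f :: "'a \<Rightarrow> complex" where "f y = (if y \<in> B then (- 1) ^ hops (eps_adj \<mu> \<epsilon>) x y else 0)" for y
  have f1: "norm (f y) = (if y \<in> B then 1 else 0)" for y by (simp add: f_def norm_power)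
  have Br: "y \<in> eps_ball \<mu> \<epsilon> x r" if "y \<in> B" for y
    using that subsetD[OF path_ball_mono[OF less_imp_le[OF s]]] by (simp add: B_def)
  have cancel: "f u + f v = 0" if "u \<in> B" "v \<in> B" "eps_adj \<mu> \<epsilon> u v" for u v
    using bipartite_in_path_ballD[OF symp_eps_adj bip Br[OF that(1)] Br[OF that(2)] that(3)] that
    by (auto simp: f_def)
  have annulus: "v \<in> A" if "u \<in> B" "v \<notin> B" "eps_adj \<mu> \<epsilon> u v" for u v
    using path_ball_step[of u "eps_adj \<mu> \<epsilon>" x s v] that by (auto simp: A_def B_def)
  have le2: "norm (f u + f v) \<le> 2" for u v
    using norm_triangle_ineq[of "f u" "f v"] by (auto simp: f1 split: if_splits)
  \<comment> \<open>Edges of the \<epsilon>-graph leaving \<open>B\<close> are charged to their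
    endpoint in \<open>A\<close>, the remaining uncancelled edges to an endpoint in
    \<open>B\<close>.\<close>
  have edge: "\<mu> u v * norm (f u + f v) \<le> \<mu> u v * indicator A u + \<mu> u v * indicator A v
      + 2 * \<epsilon> * C * (indicator B u * vmeas \<mu> u + indicator B v * vmeas \<mu> v)" (is "?L \<le> ?R1 + ?R2 + ?R3")
    if uv: "adj \<mu> u v" for u v
  proof -
    have R0: "0 \<le> ?R1" "0 \<le> ?R2" "0 \<le> ?R3"
      using weight_nonneg[of u v] m0 e C by (auto intro!: mult_nonneg_nonneg add_nonneg_nonneg)
    show ?thesis
    proof (cases "eps_adj \<mu> \<epsilon> u v")
      case True
      then have vu: "eps_adj \<mu> \<epsilon> v u" using symp_eps_adj by (auto dest: sympD)
      consider "u \<in> B" "v \<in> B" | "u \<in> B" "v \<notin> B" | "u \<notin> B" "v \<in> B" | "u \<notin> B" "v \<notin> B" by blast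
      then show ?thesis
      proof cases
        case 1
        then show ?thesis using cancel[OF 1 True] R0 by simp
      next
        case 2
        then have "norm (f u + f v) = 1" by (simp add: f_def norm_power)
        then show ?thesis using annulus[OF 2 True] R0 by simp
      next
        case 3
        then have "norm (f u + f v) = 1" by (simp add: f_def norm_power)
        then show ?thesis using annulus[OF 3(2,1) vu] R0 by simp
      next
        case 4
        then show ?thesis using R0 by (simp add: f_def)
      qed
    next
      case False
      show ?thesis
      proof (cases "u \<in> B \<or> v \<in> B")
        case True
        have "max (vmeas \<mu> u) (vmeas \<mu> v) \<le> C * vmeas \<mu> u" "max (vmeas \<mu> u) (vmeas \<mu> v) \<le> C * vmeas \<mu> v"
          using C(2)[OF uv] C(2)[of v u] uv adj_sym[of u v] C(1) m0[of u] m0[of v]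
            mult_right_mono[OF C(1) m0[of u]] mult_right_mono[OF C(1) m0[of v]] by auto
        then have "\<epsilon> * max (vmeas \<mu> u) (vmeas \<mu> v) \<le> \<epsilon> * (C * vmeas \<mu> u)"
          "\<epsilon> * max (vmeas \<mu> u) (vmeas \<mu> v) \<le> \<epsilon> * (C * vmeas \<mu> v)"
          using e by (auto intro!: mult_left_mono)
        then have w: "\<mu> u v \<le> \<epsilon> * (C * vmeas \<mu> u)" "\<mu> u v \<le> \<epsilon> * (C * vmeas \<mu> v)"
          using weight_le_of_not_eps_adj[OF False] by auto
        have pos: "0 \<le> \<epsilon> * (C * vmeas \<mu> u)" "0 \<le> \<epsilon> * (C * vmeas \<mu> v)"
          using e C(1) m0 by auto
        have "?L \<le> \<mu> u v * 2" by (intro mult_left_mono le2 weight_nonneg)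
        also have "\<dots> \<le> ?R3"
          using True w pos by (auto simp: indicator_def distrib_left mult.assoc)
        finally show ?thesis using R0 by simp
      next
        case False
        then show ?thesis using R0 by (simp add: f_def)
      qed
    qed
  qed
  define g where "g u = f u + avg (step_prob \<mu>) f u" for u
  \<comment> \<open>Since \<open>norm (g u)\<close> is at most \<open>h\<close> and
    \<open>h / 2\<close> at most 1, the \<open>p\<close>-th power is dominated by
    \<open>2 powr p\<close> times the first power, and all exponents reduce to one sum over
    edges.\<close>
  have gu: "norm (g u) powr p * vmeas \<mu> u
      \<le> 2 powr p * (\<Sum>v | adj \<mu> u v. \<mu> u v * norm (f u + f v))" for u
  proof -
    define h where "h = (\<Sum>v | adj \<mu> u v. step_prob \<mu> u v * norm (f u + f v))"
    have row: "(\<Sum>v | adj \<mu> u v. step_prob \<mu> u v) = 1"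
      using walk.row_sum[of u] by (simp add: step_prob_nonzero)
    have "g u = (\<Sum>v | adj \<mu> u v. step_prob \<mu> u v *\<^sub>R (f u + f v))"
      using row by (simp add: g_def avg_step_prob scaleR_add_right sum.distrib flip: scaleR_sum_left)
    then have gh: "norm (g u) \<le> h"
      unfolding h_def using walk.kernel_nonneg by (auto intro!: order_trans[OF norm_sum] sum_mono)
    have "h \<le> (\<Sum>v | adj \<mu> u v. step_prob \<mu> u v * 2)"
      unfolding h_def by (intro sum_mono mult_left_mono le2 walk.kernel_nonneg)
    then have h2: "h \<le> 2" using row by (simp flip: sum_distrib_right)
    have h0: "0 \<le> h" unfolding h_def using walk.kernel_nonneg by (intro sum_nonneg) auto
    have "norm (g u) powr p \<le> h powr p" using gh p by (intro powr_mono2) auto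
    also have "h powr p = 2 powr p * (h / 2) powr p" using h0 by (simp add: powr_divide)
    also have "\<dots> \<le> 2 powr p * h"
    proof (intro mult_left_mono)
      have "(h / 2) powr p \<le> (h / 2) powr 1" using h0 h2 p by (intro powr_mono') auto
      then show "(h / 2) powr p \<le> h" using h0 by simp
    qed simp
    finally have "norm (g u) powr p * vmeas \<mu> u \<le> 2 powr p * (h * vmeas \<mu> u)"
      unfolding mult.assoc[symmetric] by (intro mult_right_mono m0)
    also have "h * vmeas \<mu> u = (\<Sum>v | adj \<mu> u v. \<mu> u v * norm (f u + f v))"
      unfolding h_def sum_distrib_right using vmeas_pos[of u]
      by (intro sum.cong refl) (simp add: step_prob_def)
    finally show ?thesis .
  qed
  \<comment> \<open>The two annulus terms are summed by the definition of \<open>vmeas\<close> and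
    by invariance of the measure; the two terms in \<open>B\<close> use the degree bound
    \<open>N\<close>.\<close>
  have total: "(\<Sum>u\<in>F. \<Sum>v | adj \<mu> u v. \<mu> u v * norm (f u + f v)) \<le> 2 * MA + 4 * \<epsilon> * C * real N * MB"
    if F: "finite F" for F
  proof -
    have T1: "(\<Sum>u\<in>F. \<Sum>v | adj \<mu> u v. \<mu> u v * indicator A u) \<le> MA"
    proof -
      have "(\<Sum>u\<in>F. \<Sum>v | adj \<mu> u v. \<mu> u v * indicator A u) = (\<Sum>u\<in>F. vmeas \<mu> u * indicator A u)"
        by (simp add: vmeas_def sum_distrib_right)
      also have "\<dots> = (\<Sum>u\<in>F \<inter> A. vmeas \<mu> u)"
        using F by (simp add: sum.inter_restrict indicator_def if_distrib cong: if_cong)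
      also have "\<dots> \<le> MA" unfolding MA_def using finA m0 by (intro sum_mono2) auto
      finally show ?thesis .
    qed
    have T2: "(\<Sum>u\<in>F. \<Sum>v | adj \<mu> u v. \<mu> u v * indicator A v) \<le> MA"
    proof -
      have "(\<Sum>u\<in>F. vmeas \<mu> u * avg (step_prob \<mu>) (indicator A :: 'a \<Rightarrow> real) u) \<le> MA"
      proof (rule walk.sum_avg_le[OF _ _ F])
        fix F :: "'a set" assume F: "finite F"
        have "(\<Sum>x\<in>F. vmeas \<mu> x * indicator A x) = (\<Sum>u\<in>F \<inter> A. vmeas \<mu> u)"
          using F by (simp add: sum.inter_restrict indicator_def if_distrib cong: if_cong)
        also have "\<dots> \<le> MA" unfolding MA_def using finA m0 by (intro sum_mono2) auto
        finally show "(\<Sum>x\<in>F. vmeas \<mu> x * indicator A x) \<le> MA" .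
      qed simp
      moreover have "vmeas \<mu> u * avg (step_prob \<mu>) (indicator A :: 'a \<Rightarrow> real) u
          = (\<Sum>v | adj \<mu> u v. \<mu> u v * indicator A v)" for u
        unfolding avg_step_prob sum_distrib_left using vmeas_pos[of u]
        by (intro sum.cong refl) (simp add: step_prob_def)
      ultimately show ?thesis by simp
    qed
    have T3: "(\<Sum>u\<in>F. \<Sum>v | adj \<mu> u v. indicator B u * vmeas \<mu> u) \<le> real N * MB"
    proof -
      have "(\<Sum>u\<in>F. \<Sum>v | adj \<mu> u v. indicator B u * vmeas \<mu> u)
          \<le> (\<Sum>u\<in>F. real N * (indicator B u * vmeas \<mu> u))"
        using N m0 by (auto intro!: sum_mono mult_right_mono)
      also have "\<dots> = (\<Sum>u\<in>F \<inter> B. real N * vmeas \<mu> u)"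
        unfolding sum.inter_restrict[OF F] by (intro sum.cong refl) (simp add: indicator_def)
      also have "\<dots> = real N * (\<Sum>u\<in>F \<inter> B. vmeas \<mu> u)"
        by (simp add: sum_distrib_left)
      also have "\<dots> \<le> real N * MB"
        unfolding MB_def using finB m0 by (intro mult_left_mono sum_mono2) auto
      finally show ?thesis .
    qed
    have T4: "(\<Sum>u\<in>F. \<Sum>v | adj \<mu> u v. indicator B v * vmeas \<mu> v) \<le> real N * MB"
    proof -
      have "(\<Sum>v | adj \<mu> u v. indicator B v * vmeas \<mu> v) = (\<Sum>v\<in>B. of_bool (adj \<mu> u v) * vmeas \<mu> v)" for u
        using finB finite_adj[of u]
        by (intro sum.mono_neutral_cong) auto
      then have "(\<Sum>u\<in>F. \<Sum>v | adj \<mu> u v. indicator B v * vmeas \<mu> v)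
          = (\<Sum>v\<in>B. real (card (F \<inter> {u. adj \<mu> u v})) * vmeas \<mu> v)"
        using F by (simp add: sum.swap[of _ B] sum.If_cases of_bool_def flip: sum_distrib_right)
      also have "\<dots> \<le> (\<Sum>v\<in>B. real N * vmeas \<mu> v)"
      proof (intro sum_mono mult_right_mono m0)
        fix v
        have "card (F \<inter> {u. adj \<mu> u v}) \<le> card {u. adj \<mu> v u}"
          using finite_adj[of v] adj_sym by (intro card_mono) auto
        then show "real (card (F \<inter> {u. adj \<mu> u v})) \<le> real N" using N[of v] by simp
      qed
      finally show ?thesis by (simp add: MB_def sum_distrib_left)
    qed
    have "(\<Sum>u\<in>F. \<Sum>v | adj \<mu> u v. \<mu> u v * norm (f u + f v))
      \<le> (\<Sum>u\<in>F. \<Sum>v | adj \<mu> u v. \<mu> u v * indicator A u + \<mu> u v * indicator A v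
        + 2 * \<epsilon> * C * (indicator B u * vmeas \<mu> u + indicator B v * vmeas \<mu> v))"
      using edge by (intro sum_mono) auto
    also have "\<dots> = (\<Sum>u\<in>F. \<Sum>v | adj \<mu> u v. \<mu> u v * indicator A u)
        + (\<Sum>u\<in>F. \<Sum>v | adj \<mu> u v. \<mu> u v * indicator A v)
        + 2 * \<epsilon> * C * ((\<Sum>u\<in>F. \<Sum>v | adj \<mu> u v. indicator B u * vmeas \<mu> u)
          + (\<Sum>u\<in>F. \<Sum>v | adj \<mu> u v. indicator B v * vmeas \<mu> v))"
      by (simp only: sum.distrib sum_distrib_left distrib_left)
    also have "\<dots> \<le> MA + MA + 2 * \<epsilon> * C * (real N * MB + real N * MB)"
      using e C(1) by (intro add_mono mult_left_mono T1 T2 T3 T4) auto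
    finally show ?thesis by (simp add: algebra_simps)
  qed
  define X where "X = 2 powr p * (2 * MA + 4 * \<epsilon> * C * real N * MB)"
  have X0: "0 \<le> X" using MA0 MB0 e C(1) by (auto simp: X_def intro!: mult_nonneg_nonneg add_nonneg_nonneg)
  have "(\<Sum>u\<in>F. norm (g u) powr p * vmeas \<mu> u) \<le> X" if "finite F" for F
  proof -
    have "(\<Sum>u\<in>F. norm (g u) powr p * vmeas \<mu> u)
        \<le> 2 powr p * (\<Sum>u\<in>F. \<Sum>v | adj \<mu> u v. \<mu> u v * norm (f u + f v))"
      unfolding sum_distrib_left[of "2 powr p" _ F] by (intro sum_mono gu)
    also have "\<dots> \<le> X" unfolding X_def by (intro mult_left_mono total that) simp
    finally show ?thesis .
  qed
  then have "lq_le (vmeas \<mu>) (ereal p) (X powr (1 / p)) g"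
    using X0 p by (simp add: lq_le_ereal powr_powr)
  moreover have "f \<in> Lq (vmeas \<mu>) (ereal p)"
  proof -
    have "(\<lambda>y. norm (f y) powr p * vmeas \<mu> y) summable_on UNIV \<longleftrightarrow> (\<lambda>y. norm (f y) powr p * vmeas \<mu> y) summable_on B"
      by (intro summable_on_cong_neutral) (auto simp: f_def)
    then show ?thesis using finB by (simp add: Lq_def)
  qed
  ultimately have "lq_le (vmeas \<mu>) (ereal p) (G * X powr (1 / p)) f"
    using G unfolding walk.bounded_below_def g_def[abs_def] by blast
  then have "(\<Sum>y\<in>B. norm (f y) powr p * vmeas \<mu> y) \<le> (G * X powr (1 / p)) powr p"
    using finB by (simp add: lq_le_ereal)
  moreover have "(\<Sum>y\<in>B. norm (f y) powr p * vmeas \<mu> y) = MB"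
    unfolding MB_def by (intro sum.cong refl) (simp add: f1)
  moreover have "(G * X powr (1 / p)) powr p = G powr p * X"
    using G X0 p by (simp add: powr_mult powr_powr walk.bounded_below_def)
  ultimately show ?thesis by (simp add: X_def MA_def MB_def mult.assoc)
qed

text \<open>A bipartite ball of radius above \<open>r0\<close> contains a ball with a thin boundary.
  There the alternating function would give \<open>MB \<le> MB / 2\<close> for its positive measure
  \<open>MB\<close>.\<close>

lemma bipartite_bound_of_bounded_below:
  assumes vol: "polynomial_volume \<mu>" and p: "1 \<le> p" and G: "walk.bounded_below (ereal p) G"
  shows "\<exists>\<epsilon>>0. \<exists>r0::nat. r0 \<ge> 1 \<and>
    (\<forall>x. \<forall>r\<ge>1. eps_bipartite \<mu> \<epsilon> (eps_ball \<mu> \<epsilon> x r) \<longrightarrow> r \<le> r0)"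
proof -
  obtain N where N: "\<And>x. card {y. adj \<mu> x y} \<le> N" using degree_bound by blast
  obtain C where C: "1 \<le> C" "\<And>x y. adj \<mu> x y \<Longrightarrow> vmeas \<mu> y \<le> C * vmeas \<mu> x"
    by (rule neighbour_vmeas_bound[OF vol]) (rule that)
  define H where "H = G powr p * 2 powr p + 1"
  have H: "0 < H" "G powr p * 2 powr p \<le> H" unfolding H_def by (auto intro: add_nonneg_pos)
  \<comment> \<open>\<open>\<epsilon>\<close> and \<open>\<delta>\<close> are chosen so that the
    non-\<epsilon>-edges and the annulus contribute at most a quarter of \<open>MB\<close> each. The
    1 added in \<open>H\<close> and to \<open>N\<close> keeps the denominators positive.\<close>
  define \<epsilon> where "\<epsilon> = 1 / (16 * H * C * (real N + 1))"
  have e: "0 < \<epsilon>" using H C(1) by (auto simp: \<epsilon>_def intro!: divide_pos_pos mult_pos_pos)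
  have "H * (4 * \<epsilon> * C * real N) = real N / (4 * (real N + 1))"
    using H C(1) by (simp add: \<epsilon>_def)
  also have "\<dots> \<le> 1/4" by (simp add: field_simps)
  finally have He: "H * (4 * \<epsilon> * C * real N) \<le> 1/4" .
  define \<delta> where "\<delta> = 1 / (8 * H)"
  have d: "0 < \<delta>" "H * (2 * \<delta>) = 1/4" using H by (auto simp: \<delta>_def)
  obtain r0 where r0: "1 \<le> r0" "\<And>\<epsilon> x (r::nat). 0 < \<epsilon> \<Longrightarrow> r0 < r \<Longrightarrow> \<exists>s\<ge>1. s < r \<and>
       (\<Sum>y\<in>eps_ball \<mu> \<epsilon> x (Suc s) - eps_ball \<mu> \<epsilon> x s. vmeas \<mu> y) \<le> \<delta> * (\<Sum>y\<in>eps_ball \<mu> \<epsilon> x s. vmeas \<mu> y)"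
    by (rule thin_annulus[OF vol d(1)]) (rule that)
  have "r \<le> r0" if bip: "eps_bipartite \<mu> \<epsilon> (eps_ball \<mu> \<epsilon> x r)" for x r
  proof (rule ccontr)
    assume "\<not> r \<le> r0"
    then obtain s where s: "1 \<le> s" "s < r" and
      thin: "(\<Sum>y\<in>eps_ball \<mu> \<epsilon> x (Suc s) - eps_ball \<mu> \<epsilon> x s. vmeas \<mu> y) \<le> \<delta> * (\<Sum>y\<in>eps_ball \<mu> \<epsilon> x s. vmeas \<mu> y)"
      using r0(2)[OF e, of r x] by auto
    define MB where "MB = (\<Sum>y\<in>eps_ball \<mu> \<epsilon> x s. vmeas \<mu> y)"
    have "0 < MB"
    proof -
      have "x \<in> eps_ball \<mu> \<epsilon> x s" using s(1) by (intro center_in_path_ball) simp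
      then show ?thesis
        unfolding MB_def by (intro sum_pos finite_eps_ball[OF e] vmeas_pos) auto
    qed
    have "MB \<le> G powr p * 2 powr p *
        (2 * (\<Sum>y\<in>eps_ball \<mu> \<epsilon> x (Suc s) - eps_ball \<mu> \<epsilon> x s. vmeas \<mu> y) + 4 * \<epsilon> * C * real N * MB)"
      unfolding MB_def by (rule alternating_function_bound[OF p e N C bip s(2) G])
    also have "\<dots> \<le> H * (2 * (\<delta> * MB) + 4 * \<epsilon> * C * real N * MB)"
      using thin H \<open>0 < MB\<close> e C(1) vmeas_pos
      by (intro mult_mono add_mono mult_left_mono)
        (auto simp: MB_def less_imp_le intro!: add_nonneg_nonneg sum_nonneg mult_nonneg_nonneg)
    also have "\<dots> = H * (2 * \<delta>) * MB + H * (4 * \<epsilon> * C * real N) * MB" by (simp add: algebra_simps)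
    also have "\<dots> \<le> 1/4 * MB + 1/4 * MB"
      using d(2) He \<open>0 < MB\<close> by (intro add_mono mult_right_mono) auto
    finally show False using \<open>0 < MB\<close> by simp
  qed
  then show ?thesis using e r0(1) by blast
qed

end

section \<open>The cycle of implications\<close>

theorem theorem1p7:
  fixes \<mu> :: "'a \<Rightarrow> 'a \<Rightarrow> real"
  assumes "weighted_graph \<mu>"
    and "polynomial_volume \<mu>"
  shows
    "let
       i = markov_analytic \<mu> 2;
       ii = (\<forall>q::real. 1 < q \<longrightarrow> markov_analytic \<mu> (ereal q));
       iii = (\<forall>q::ereal. 1 \<le> q \<longrightarrow> - 1 \<notin> Lq_spectrum (vmeas \<mu>) q (markov \<mu>));
       iv = (\<exists>q::ereal. 1 \<le> q \<and> q < \<infinity> \<and> - 1 \<notin> Lq_spectrum (vmeas \<mu>) q (markov \<mu>));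
       v = (\<exists>k::nat. \<exists>\<epsilon>>0. \<forall>x. kern_iter \<mu> (2 * k + 1) x x * vmeas \<mu> x \<ge> \<epsilon>);
       vi = (\<exists>\<epsilon>>0. \<exists>r0::nat. r0 \<ge> 1 \<and>
               (\<forall>x. \<forall>r\<ge>1. eps_bipartite \<mu> \<epsilon> (eps_ball \<mu> \<epsilon> x r) \<longrightarrow> r \<le> r0))
     in (i \<longleftrightarrow> ii) \<and> (i \<longleftrightarrow> iii) \<and> (i \<longleftrightarrow> iv) \<and> (i \<longleftrightarrow> v) \<and> (i \<longleftrightarrow> vi)"
proof -
  interpret weighted_graph \<mu> by fact
  define i where "i \<longleftrightarrow> markov_analytic \<mu> 2"
  define ii where "ii \<longleftrightarrow> (\<forall>q::real. 1 < q \<longrightarrow> markov_analytic \<mu> (ereal q))"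
  define iii where "iii \<longleftrightarrow> (\<forall>q::ereal. 1 \<le> q \<longrightarrow> - 1 \<notin> Lq_spectrum (vmeas \<mu>) q (markov \<mu>))"
  define iv where "iv \<longleftrightarrow> (\<exists>q::ereal. 1 \<le> q \<and> q < \<infinity> \<and> - 1 \<notin> Lq_spectrum (vmeas \<mu>) q (markov \<mu>))"
  define v where "v \<longleftrightarrow> (\<exists>k::nat. \<exists>\<epsilon>>0. \<forall>x. kern_iter \<mu> (2 * k + 1) x x * vmeas \<mu> x \<ge> \<epsilon>)"
  define vi where "vi \<longleftrightarrow> (\<exists>\<epsilon>>0. \<exists>r0::nat. r0 \<ge> 1 \<and>
               (\<forall>x. \<forall>r\<ge>1. eps_bipartite \<mu> \<epsilon> (eps_ball \<mu> \<epsilon> x r) \<longrightarrow> r \<le> r0))"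
  \<comment> \<open>Both halves of the invertibility of \<open>I + P\<close> on one
    \<open>Lq\<close>: the first suffices for (ii), the two together give (iii).\<close>
  have v_below_surj: "(\<exists>G. walk.bounded_below q G) \<and>
      (\<forall>f \<in> Lq (vmeas \<mu>) q. \<exists>g. g \<in> Lq (vmeas \<mu>) q \<and> (\<lambda>x. g x + avg (step_prob \<mu>) g x) = f)"
    if "v" "1 \<le> q" for q
  proof -
    obtain k e where e: "0 < e" "\<And>x. e \<le> kpow (step_prob \<mu>) (2 * k + 1) x x"
      using \<open>v\<close> unfolding v_def kern_iter_mult_vmeas by blast
    have n: "odd (2 * k + 1)" by simp
    have "\<exists>G. walk.bounded_below q G"
      using walk.odd_return_bounded_below[OF \<open>1 \<le> q\<close> n e] by blast
    moreover have "\<exists>g. g \<in> Lq (vmeas \<mu>) q \<and> (\<lambda>x. g x + avg (step_prob \<mu>) g x) = f"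
      if f: "f \<in> Lq (vmeas \<mu>) q" for f
      by (rule walk.odd_return_surjective[OF \<open>1 \<le> q\<close> n e f]) auto
    ultimately show ?thesis by blast
  qed
  have v_ii: ii if v: v
    unfolding ii_def
  proof (intro allI impI)
    fix q :: real assume q: "1 < q"
    then obtain G where G: "walk.bounded_below (ereal q) G" using v_below_surj[OF v, of "ereal q"] by auto
    show "markov_analytic \<mu> (ereal q)"
      unfolding markov_analytic_def markov_eq_avg
      by (rule walk.analytic_of_bounded_below[OF q G]) blast
  qed
  have v_iii: iii if v: v
    unfolding iii_def markov_eq_avg
  proof (intro allI impI)
    fix q :: ereal assume q: "1 \<le> q"
    obtain G where G: "walk.bounded_below q G" using v_below_surj[OF v q] by blast
    show "- 1 \<notin> Lq_spectrum (vmeas \<mu>) q (avg (step_prob \<mu>))"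
      by (rule walk.minus_one_notin_spectrumI[OF q G]) (use v_below_surj[OF v q] in blast)
  qed
  have ii_i: i if ii
  proof -
    have "markov_analytic \<mu> (ereal 2)" using that unfolding ii_def by simp
    moreover have "ereal 2 = 2" by simp
    ultimately show ?thesis unfolding i_def by (simp only:)
  qed
  have iii_iv: iv if iii
    using that unfolding iii_def iv_def by (intro exI[of _ 1]) auto
  have vi_v: v if vi: vi
  proof -
    obtain e r0 where e: "0 < e" and r0: "\<And>x r. 1 \<le> r \<Longrightarrow> eps_bipartite \<mu> e (eps_ball \<mu> e x r) \<Longrightarrow> r \<le> r0"
      using vi unfolding vi_def by blast
    show v
      unfolding v_def kern_iter_mult_vmeas
      using odd_return_of_bipartite_bound[OF e r0] e by (intro exI[of _ r0] exI[of _ "e ^ (2 * r0 + 1)"]) auto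
  qed
  have below_vi: vi if "walk.bounded_below (ereal p) G" "1 \<le> p" for p G
    unfolding vi_def by (rule bipartite_bound_of_bounded_below[OF assms(2) that(2,1)])
  have iv_vi: vi if iv: iv
  proof -
    from iv[unfolded iv_def markov_eq_avg] obtain q :: ereal
      where q3: "1 \<le> q \<and> q < \<infinity> \<and> - 1 \<notin> Lq_spectrum (vmeas \<mu>) q (avg (step_prob \<mu>))" ..
    then have q: "1 \<le> q" "q < \<infinity>" "- 1 \<notin> Lq_spectrum (vmeas \<mu>) q (avg (step_prob \<mu>))" by simp_all
    from q(1,2) obtain p where p: "q = ereal p" "1 \<le> p" by (cases q) auto
    obtain G where "walk.bounded_below q G"
      using walk.bounded_below_of_spectrum[OF q(1,3)] by blast
    then show vi unfolding p(1) using p(2) by (rule below_vi)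
  qed
  have i_vi: vi if i: i
  proof -
    obtain C where C: "\<And>k. 1 \<le> k \<Longrightarrow> Lq_opnorm (vmeas \<mu>) (ereal 2)
        (\<lambda>f x. (avg (step_prob \<mu>) ^^ k) f x - avg (step_prob \<mu>) ((avg (step_prob \<mu>) ^^ k) f) x) \<le> ereal (C / real k)"
      using i unfolding i_def markov_analytic_def markov_eq_avg by auto
    obtain G where "walk.bounded_below (ereal 2) G"
      by (rule walk.bounded_below_of_analytic[OF _ C]) auto
    then show vi by (rule below_vi) simp
  qed
  \<comment> \<open>Two cycles share the link from (vi) to (v): one runs from (v) through (ii) and
    (i) to (vi), the other through (iii) and (iv).\<close>
  have "(i \<longleftrightarrow> ii) \<and> (i \<longleftrightarrow> iii) \<and> (i \<longleftrightarrow> iv) \<and> (i \<longleftrightarrow> v) \<and> (i \<longleftrightarrow> vi)"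
    using v_ii v_iii ii_i iii_iv vi_v iv_vi i_vi by blast
  then show ?thesis
    unfolding Let_def i_def ii_def iii_def iv_def v_def vi_def .
qed

end
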